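(* Let $0<S<T<\infty$ and let $(X^{(1/2)}_t)_{t\in[0,T]}$ be the $\alpha$-Wiener bridge on $[0,T]$ with $\alpha=1/2$. Then $$\int_0^S\frac{(X_u^{(1/2)})^2}{(T-u)^2}\,du=\left(\ln\left(\frac{T}{T-S}\right)\right)^2\sum_{k=1}^\infty\frac{1}{(k-1/2)^2\pi^2}\,\xi_k^2,$$ where $\xi_k$, $k\in\mathbb{N}$, are independent standard normally distributed random variables.
   Context: Let $(B_t)_{t\ge 0}$ be a standard Wiener process. For $\alpha>0$ and $T\in(0,\infty)$ the $\alpha$-Wiener bridge on $[0,T]$ is the process $X_t^{(\alpha)}=\int_0^t\big(\frac{T-t}{T-s}\big)^\alpha\,dB_s$, $t\in[0,T)$, i.e. the unique strong solution of $dX_t^{(\alpha)}=-\frac{\alpha}{T-t}X_t^{(\alpha)}\,dt+dB_t$, $X_0^{(\alpha)}=0$, extended by $X_T^{(\alpha)}=0$ (the extension is almost surely continuous on $[0,T]$). The equality of random variables is understood with probability one: there exist independent standard normal $\xi_k$ on the underlying probability space for which it holds almost surely. *)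

theory Defs
  imports "HOL-Probability.Probability"
begin

locale standard_wiener_process = prob_space M
  for M :: "'a measure" and B :: "real \<Rightarrow> 'a \<Rightarrow> real" +
  assumes rv: "t \<ge> 0 \<Longrightarrow> random_variable borel (B t)"
    and start: "AE \<omega> in M. B 0 \<omega> = 0"
    and increment_normal: "0 \<le> s \<Longrightarrow> s < t \<Longrightarrow>
      distributed M lborel (\<lambda>\<omega>. B t \<omega> - B s \<omega>) (normal_density 0 (sqrt (t - s)))"
    and increments_indep: "0 \<le> \<tau> (0::nat) \<Longrightarrow> (\<And>i. i < n \<Longrightarrow> \<tau> i < \<tau> (Suc i)) \<Longrightarrow>
      indep_vars (\<lambda>_. borel) (\<lambda>i \<omega>. B (\<tau> (Suc i)) \<omega> - B (\<tau> i) \<omega>) {..<n}"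
    and paths: "AE \<omega> in M. continuous_on {0..} (\<lambda>t. B t \<omega>)"

text \<open>A list of triples \<open>(a, b, c)\<close> encodes the step function that is the sum of the functions
  \<open>c\<close> times the indicator of \<open>(a, b]\<close>; the intervals may overlap.\<close>

definition step_fun :: "(real \<times> real \<times> real) list \<Rightarrow> real \<Rightarrow> real" where
  "step_fun xs s = (\<Sum>(a, b, c)\<leftarrow>xs. c * indicator {a<..b} s)"

definition step_integral ::
  "(real \<Rightarrow> 'a \<Rightarrow> real) \<Rightarrow> (real \<times> real \<times> real) list \<Rightarrow> 'a \<Rightarrow> real" where
  "step_integral B xs \<omega> = (\<Sum>(a, b, c)\<leftarrow>xs. c * (B b \<omega> - B a \<omega>))"

text \<open>\<open>Y\<close> is a version of the stochastic integral of the deterministic function \<open>f\<close> over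
  \<open>[0, t]\<close> with respect to \<open>B\<close>: the mean-square limit of integrals of step functions that
  converge to \<open>f\<close> in \<open>L\<^sup>2[0, t]\<close>.  By the Ito isometry \<open>Y\<close> is unique up to null sets.
  Nonnegative integrals are used so that convergence to 0 cannot hold through the default value
  of a divergent Bochner integral.\<close>

definition is_wiener_integral ::
  "'a measure \<Rightarrow> (real \<Rightarrow> 'a \<Rightarrow> real) \<Rightarrow> real \<Rightarrow> (real \<Rightarrow> real) \<Rightarrow> ('a \<Rightarrow> real) \<Rightarrow> bool" where
  "is_wiener_integral M B t f Y \<longleftrightarrow>
     set_borel_measurable lborel {0..t} f \<and> Y \<in> borel_measurable M \<and>
     (\<exists>xs :: nat \<Rightarrow> (real \<times> real \<times> real) list.
        (\<forall>n. \<forall>(a, b, c) \<in> set (xs n). 0 \<le> a \<and> a \<le> b \<and> b \<le> t) \<and>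
        (\<lambda>n. \<integral>\<^sup>+ s\<in>{0..t}. ennreal ((f s - step_fun (xs n) s)\<^sup>2) \<partial>lborel)
           \<longlonglongrightarrow> 0 \<and>
        (\<lambda>n. \<integral>\<^sup>+ \<omega>. ennreal ((Y \<omega> - step_integral B (xs n) \<omega>)\<^sup>2) \<partial>M)
           \<longlonglongrightarrow> 0)"

text \<open>The stochastic integral fixes each \<open>X t\<close> only up to a null set, so the continuous version
  is singled out by \<open>bridge_paths\<close>.  Continuity at \<open>T\<close> is a consequence and is not required.\<close>

locale alpha_wiener_bridge = standard_wiener_process M B
  for M :: "'a measure" and B :: "real \<Rightarrow> 'a \<Rightarrow> real" +
  fixes \<alpha> T :: real and X :: "real \<Rightarrow> 'a \<Rightarrow> real"
  assumes alpha_pos: "\<alpha> > 0"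
    and T_pos: "T > 0"
    and bridge_integral: "0 \<le> t \<Longrightarrow> t < T \<Longrightarrow>
      is_wiener_integral M B t (\<lambda>s. ((T - t) / (T - s)) powr \<alpha>) (X t)"
    and bridge_paths: "AE \<omega> in M. continuous_on {0..<T} (\<lambda>t. X t \<omega>)"
    and bridge_end: "AE \<omega> in M. X T \<omega> = 0"

end

theory Submission
  imports Defs
begin

text \<open>With \<open>L = ln (T / (T - S))\<close> and the clock \<open>u(v) = T (1 - exp (- L v))\<close>, the process
  \<open>W v = X (u v) / sqrt (L (T - u v))\<close> is, on \<open>[0, 1]\<close>, a Gaussian process with covariance
  \<open>min v v'\<close>, and substitution gives \<open>\<integral>\<^sub>0\<^sup>S X\<^sup>2 / (T - u)\<^sup>2 du = L\<^sup>2 \<integral>\<^sub>0\<^sup>1 W\<^sup>2 dv\<close>.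
  The \<open>\<xi> k\<close> are the normalized coefficients of the paths of \<open>W\<close> in the orthonormal basis
  \<open>sqrt 2 sin ((k - 1/2) \<pi> v)\<close>, and the expansion of the integral is Parseval's identity.  The
  coefficients are limits of Riemann sums of \<open>W\<close>, so their joint characteristic function is the
  limit of Gaussian ones.  It factorizes into standard normal characteristic functions, which gives
  independence by Levy's uniqueness theorem.\<close>

subsection \<open>Riemann sums\<close>

text \<open>For s \<le> t the bridge with \<alpha> = 1/2 has covariance sqrt ((T - s) (T - t)) ln (T
  / (T - s)). Once the factors sqrt (T - u) are divided out, only the clock ln (T / (T - u)) is
  left, and \<open>clock\<close> is its inverse, scaled to [0, 1]. For general \<alpha>, division by
  (T - u) powr \<alpha> gives a clock with density (T - u) powr (- 2 \<alpha>), in which the weight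
  of the squared path is (T - u) powr (4 \<alpha> - 2). It is constant exactly at \<alpha> = 1/2,
  which is why the plain eigenvalues of the kernel min appear. The \<xi> k must live on the given
  probability space and the identity holds path by path, so an equality in law would not do: the
  coefficients are functionals of the path of W, and probability enters only through finite linear
  combinations of values of W. Levy's theorem identifies laws on the line, while independence
  concerns several variables at once; changes of measure bridge this gap.\<close>

lemma has_integral_ceiling_grid:
  fixes f :: "real \<Rightarrow> real" and n k :: nat
  assumes "n > 0"
  shows "((\<lambda>u. f (of_int \<lceil>real n * u\<rceil> / real n)) has_integral
    (\<Sum>j<k. f (real (Suc j) / real n) / real n)) {0..real k / real n}"
proof (induction k)
  case 0
  then show ?case by (simp add: has_integral_refl)
next
  case (Suc k)
  have "((\<lambda>u. f (real (Suc k) / real n)) has_integral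
      (real (Suc k) / real n - real k / real n) *\<^sub>R f (real (Suc k) / real n))
      {real k / real n..real (Suc k) / real n}"
    using assms by (intro has_integral_const_real[THEN has_integral_eq_rhs]) (auto simp: divide_right_mono)
  moreover have "f (of_int \<lceil>real n * u\<rceil> / real n) = f (real (Suc k) / real n)"
    if "u \<in> {real k / real n..real (Suc k) / real n} - {real k / real n}" for u
  proof -
    have "real k / real n < u" "u \<le> real (Suc k) / real n"
      using that by auto
    then have "real k < real n * u" "real n * u \<le> real (Suc k)"
      using assms by (auto simp: field_simps)
    then have "\<lceil>real n * u\<rceil> = int (Suc k)"
      by (simp add: ceiling_eq_iff)
    then show ?thesis by simp
  qed
  ultimately have step: "((\<lambda>u. f (of_int \<lceil>real n * u\<rceil> / real n)) has_integral
      (real (Suc k) / real n - real k / real n) *\<^sub>R f (real (Suc k) / real n))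
      {real k / real n..real (Suc k) / real n}"
    by (rule has_integral_spike_finite[OF finite.insertI[OF finite.emptyI], rotated])
  from has_integral_combine[OF _ _ Suc step] show ?case
    by (simp add: divide_right_mono add_divide_distrib)
qed

lemma ceiling_grid_bounds:
  fixes u :: real and n :: nat
  assumes "n > 0"
  shows "u \<le> of_int \<lceil>real n * u\<rceil> / real n" "of_int \<lceil>real n * u\<rceil> / real n \<le> u + 1 / real n"
proof -
  have "real n * u \<le> of_int \<lceil>real n * u\<rceil>" "of_int \<lceil>real n * u\<rceil> \<le> real n * u + 1"
    by linarith+
  with assms show "u \<le> of_int \<lceil>real n * u\<rceil> / real n" "of_int \<lceil>real n * u\<rceil> / real n \<le> u + 1 / real n"
    by (simp_all add: field_simps)
qed

lemma ceiling_grid_tendsto: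
  fixes u :: real
  shows "(\<lambda>n. of_int \<lceil>real (Suc n) * u\<rceil> / real (Suc n)) \<longlonglongrightarrow> u"
proof (rule tendsto_sandwich)
  show "(\<lambda>n. u) \<longlonglongrightarrow> u" by simp
  have "(\<lambda>n. u + 1 / real (Suc n)) \<longlonglongrightarrow> u + 0"
    by (intro tendsto_intros LIMSEQ_inverse_real_of_nat[unfolded inverse_eq_divide])
  then show "(\<lambda>n. u + 1 / real (Suc n)) \<longlonglongrightarrow> u" by simp
qed (use ceiling_grid_bounds[of "Suc _" u] in \<open>auto intro!: always_eventually\<close>)

lemma ceiling_grid_mem:
  fixes u :: real and n :: nat
  assumes "n > 0" "u \<in> {0..1}"
  shows "of_int \<lceil>real n * u\<rceil> / real n \<in> {0..1}"
proof -
  have "0 \<le> real n * u" "real n * u \<le> real n"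
    using assms by (auto simp: mult_left_le)
  then have "0 \<le> \<lceil>real n * u\<rceil>" "\<lceil>real n * u\<rceil> \<le> int n"
    by (auto simp: ceiling_le_iff le_ceiling_iff)
  with assms show ?thesis by (simp add: divide_le_eq)
qed

text \<open>The sum is the exact integral of f evaluated at u rounded up to the grid, so dominated
  convergence applies. Convergence is required only along the rounded points, which lie to the right
  of u, so that f may jump as long as it is continuous from the right.\<close>

lemma Riemann_sum_tendsto_integral:
  fixes f g :: "real \<Rightarrow> real"
  assumes bounded: "\<And>u. u \<in> {0..1} \<Longrightarrow> \<bar>f u\<bar> \<le> C"
    and lim: "\<And>u. u \<in> {0..1} \<Longrightarrow> (\<lambda>n. f (of_int \<lceil>real (Suc n) * u\<rceil> / real (Suc n))) \<longlonglongrightarrow> g u"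
  shows "(\<lambda>n. \<Sum>j<Suc n. f (real (Suc j) / real (Suc n)) / real (Suc n)) \<longlonglongrightarrow> integral {0..1} g"
proof -
  have int: "((\<lambda>u. f (of_int \<lceil>real (Suc n) * u\<rceil> / real (Suc n))) has_integral
      (\<Sum>j<Suc n. f (real (Suc j) / real (Suc n)) / real (Suc n))) {0..1}" for n
    using has_integral_ceiling_grid[of "Suc n" f "Suc n"] by simp
  have "(\<lambda>n. integral {0..1} (\<lambda>u. f (of_int \<lceil>real (Suc n) * u\<rceil> / real (Suc n)))) \<longlonglongrightarrow> integral {0..1} g"
  proof (rule dominated_convergence(2))
    show "(\<lambda>u. C) integrable_on {0..1::real}" by (rule integrable_const_ivl)
    show "norm (f (of_int \<lceil>real (Suc n) * u\<rceil> / real (Suc n))) \<le> C" if "u \<in> {0..1}" for n u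
      unfolding real_norm_def using bounded ceiling_grid_mem[OF _ that, of "Suc n"] by blast
  qed (use int lim in \<open>auto simp: integrable_on_def\<close>)
  then show ?thesis
    by (simp only: integral_unique[OF int])
qed

lemma Riemann_sum_tendsto_integral_continuous:
  fixes f :: "real \<Rightarrow> real"
  assumes "continuous_on {0..1} f"
  shows "(\<lambda>n. \<Sum>j<Suc n. f (real (Suc j) / real (Suc n)) / real (Suc n)) \<longlonglongrightarrow> integral {0..1} f"
proof -
  have "bounded (f ` {0..1})"
    using assms compact_continuous_image compact_imp_bounded by blast
  then obtain C where "\<And>u. u \<in> {0..1} \<Longrightarrow> \<bar>f u\<bar> \<le> C"
    unfolding bounded_iff real_norm_def by blast
  then show ?thesis
  proof (rule Riemann_sum_tendsto_integral)
    show "(\<lambda>n. f (of_int \<lceil>real (Suc n) * u\<rceil> / real (Suc n))) \<longlonglongrightarrow> f u" if u: "u \<in> {0..1}" for u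
    proof (rule continuous_on_tendsto_compose[OF assms ceiling_grid_tendsto u])
      show "\<forall>\<^sub>F n in sequentially. of_int \<lceil>real (Suc n) * u\<rceil> / real (Suc n) \<in> {0..1::real}"
        using ceiling_grid_mem[OF _ u, of "Suc _"] by (blast intro: always_eventually)
    qed
  qed
qed

text \<open>The indicator of \<open>{x..}\<close> is continuous from the right and rounding up
  approaches u from the right, so the jump at x does no harm. Read as functions of x, these sums are
  the step functions whose squares integrate to the covariance form of W.\<close>

lemma Riemann_sum_tail_tendsto_integral:
  fixes h :: "real \<Rightarrow> real"
  assumes "continuous_on {0..1} h" and x: "x \<in> {0..1}"
  shows "(\<lambda>n. \<Sum>j<Suc n. (h (real (Suc j) / real (Suc n)) / real (Suc n)) * indicator {..real (Suc j) / real (Suc n)} x)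
    \<longlonglongrightarrow> integral {x..1} h"
proof -
  have "bounded (h ` {0..1})"
    using assms compact_continuous_image compact_imp_bounded by blast
  then obtain C where C: "\<And>u. u \<in> {0..1} \<Longrightarrow> \<bar>h u\<bar> \<le> C"
    unfolding bounded_iff real_norm_def by blast
  have "(\<lambda>n. \<Sum>j<Suc n. (h (real (Suc j) / real (Suc n)) * indicator {x..} (real (Suc j) / real (Suc n))) / real (Suc n))
    \<longlonglongrightarrow> integral {0..1} (\<lambda>u. h u * indicator {x..} u)"
  proof (rule Riemann_sum_tendsto_integral[where C = C])
    show "\<bar>h u * indicator {x..} u\<bar> \<le> C" if "u \<in> {0..1}" for u
      using C[OF that] by (auto simp: indicator_def)
    show "(\<lambda>n. h (of_int \<lceil>real (Suc n) * u\<rceil> / real (Suc n)) * indicator {x..} (of_int \<lceil>real (Suc n) * u\<rceil> / real (Suc n) :: real))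
       \<longlonglongrightarrow> h u * indicator {x..} u" if u: "u \<in> {0..1}" for u
    proof (rule tendsto_mult)
      show "(\<lambda>n. h (of_int \<lceil>real (Suc n) * u\<rceil> / real (Suc n))) \<longlonglongrightarrow> h u"
      proof (rule continuous_on_tendsto_compose[OF assms(1) ceiling_grid_tendsto u])
        show "\<forall>\<^sub>F n in sequentially. of_int \<lceil>real (Suc n) * u\<rceil> / real (Suc n) \<in> {0..1::real}"
          using ceiling_grid_mem[OF _ u, of "Suc _"] by (blast intro: always_eventually)
      qed
      show "(\<lambda>n. indicator {x..} (of_int \<lceil>real (Suc n) * u\<rceil> / real (Suc n) :: real)) \<longlonglongrightarrow> (indicator {x..} u :: real)"
      proof (cases "x \<le> u")
        case True
        then have "x \<le> of_int \<lceil>real (Suc n) * u\<rceil> / real (Suc n)" for n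
          using ceiling_grid_bounds(1)[of "Suc n" u] by simp
        with True show ?thesis by (simp add: indicator_def)
      next
        case False
        then have "\<forall>\<^sub>F n in sequentially. of_int \<lceil>real (Suc n) * u\<rceil> / real (Suc n) < x"
          using order_tendstoD(2)[OF ceiling_grid_tendsto] by simp
        with False show ?thesis
          by (intro tendsto_eventually) (auto elim!: eventually_mono simp: indicator_def)
      qed
    qed
  qed
  moreover have "integral {0..1} (\<lambda>u. h u * indicator {x..} u) = integral {x..1} h"
  proof -
    have "integral {0..1} (\<lambda>u. h u * indicator {x..} u) = integral {0..1} (\<lambda>u. if u \<in> {x..1} then h u else 0)"
      by (rule integral_cong) (auto simp: indicator_def)
    also have "\<dots> = integral ({x..1} \<inter> {0..1}) h"
      by (rule integral_restrict_Int)
    also have "{x..1} \<inter> {0..1} = {x..1}" using x by auto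
    finally show ?thesis .
  qed
  moreover have "(h (real (Suc j) / real (Suc n)) * indicator {x..} (real (Suc j) / real (Suc n))) / real (Suc n)
     = (h (real (Suc j) / real (Suc n)) / real (Suc n)) * indicator {..real (Suc j) / real (Suc n)} x" for j n
    by (auto simp: indicator_def)
  ultimately show ?thesis by (simp only:)
qed

subsection \<open>Completeness of the half-integer sine system\<close>

text \<open>Sums and differences of half-integer frequencies are integers, so products of two modes
  reduce to these integrals.\<close>

lemma integral_cos_int_pi:
  fixes m :: int
  shows "((\<lambda>v. cos (of_int m * pi * v)) has_integral (if m = 0 then 1 else 0)) {0..1::real}"
proof (cases "m = 0")
  case True
  then show ?thesis
    using has_integral_const_real[of "1::real" 0 1] by simp
next
  case False
  have "((\<lambda>v. cos (of_int m * pi * v)) has_integral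
      (sin (of_int m * pi * 1) / (of_int m * pi) - sin (of_int m * pi * 0) / (of_int m * pi))) {0..1::real}"
    using False
    by (intro fundamental_theorem_of_calculus)
       (auto intro!: derivative_eq_intros simp flip: has_real_derivative_iff_has_vector_derivative)
  with False show ?thesis
    by (simp add: mult.commute[of _ pi])
qed

text \<open>The normalized eigenfunctions of the kernel min on [0, 1], with eigenvalue 1 / ((k +
  1/2) \<pi>)^2: they vanish at 0 and have derivative 0 at 1. Counting starts at 0, hence k + 1/2 in
  place of k - 1/2.\<close>

definition sin_mode :: "nat \<Rightarrow> real \<Rightarrow> real" where
  "sin_mode k v = sqrt 2 * sin ((real k + 1/2) * pi * v)"

definition cos_mode :: "nat \<Rightarrow> real \<Rightarrow> real" where
  "cos_mode k v = sqrt 2 * cos ((real k + 1/2) * pi * v)"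

lemma continuous_on_modes [continuous_intros]:
  "continuous_on A (sin_mode k)" "continuous_on A (cos_mode k)"
  unfolding sin_mode_def cos_mode_def by (intro continuous_intros)+

lemma has_integral_sin_mode_mult:
  "((\<lambda>v. sin_mode i v * sin_mode j v) has_integral (if i = j then 1 else 0)) {0..1}"
proof -
  have "sin_mode i v * sin_mode j v =
      cos (of_int (int i - int j) * pi * v) - cos (of_int (int i + int j + 1) * pi * v)" for v
  proof -
    have "sin_mode i v * sin_mode j v = 2 * (sin ((real i + 1/2) * pi * v) * sin ((real j + 1/2) * pi * v))"
      by (simp add: sin_mode_def)
    also have "\<dots> = cos ((real i + 1/2) * pi * v - (real j + 1/2) * pi * v)
        - cos ((real i + 1/2) * pi * v + (real j + 1/2) * pi * v)"
      by (simp add: sin_times_sin)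
    finally show ?thesis by (simp add: algebra_simps)
  qed
  moreover have "int i + int j + 1 \<noteq> 0" by linarith
  ultimately show ?thesis
    using has_integral_diff[OF integral_cos_int_pi[of "int i - int j"] integral_cos_int_pi[of "int i + int j + 1"]]
    by simp
qed

lemma has_integral_cos_mode_mult:
  "((\<lambda>v. cos_mode i v * cos_mode j v) has_integral (if i = j then 1 else 0)) {0..1}"
proof -
  have "cos_mode i v * cos_mode j v =
      cos (of_int (int i - int j) * pi * v) + cos (of_int (int i + int j + 1) * pi * v)" for v
  proof -
    have "cos_mode i v * cos_mode j v = 2 * (cos ((real i + 1/2) * pi * v) * cos ((real j + 1/2) * pi * v))"
      by (simp add: cos_mode_def)
    also have "\<dots> = cos ((real i + 1/2) * pi * v - (real j + 1/2) * pi * v)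
        + cos ((real i + 1/2) * pi * v + (real j + 1/2) * pi * v)"
      by (simp add: cos_times_cos)
    finally show ?thesis by (simp add: algebra_simps)
  qed
  moreover have "int i + int j + 1 \<noteq> 0" by linarith
  ultimately show ?thesis
    using has_integral_add[OF integral_cos_int_pi[of "int i - int j"] integral_cos_int_pi[of "int i + int j + 1"]]
    by simp
qed

text \<open>The half-integer frequency makes the boundary term at 1 vanish, so the tail integral is
  a pure cosine mode without an additive constant.\<close>

lemma has_integral_sin_mode_tail:
  assumes "x \<in> {0..1}"
  shows "((\<lambda>v. (real k + 1/2) * pi * sin_mode k v) has_integral cos_mode k x) {x..1}"
proof -
  have "((\<lambda>v. (real k + 1/2) * pi * sin_mode k v) has_integral (- cos_mode k 1 - (- cos_mode k x))) {x..1}"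
    unfolding sin_mode_def cos_mode_def using assms
    by (intro fundamental_theorem_of_calculus)
       (auto intro!: derivative_eq_intros simp flip: has_real_derivative_iff_has_vector_derivative)
  moreover have "cos_mode k 1 = 0"
  proof -
    have "cos ((real k + 1/2) * pi) = cos (real k * pi + pi / 2)"
      by (simp add: algebra_simps)
    also have "\<dots> = 0"
      by (simp add: cos_add)
    finally show ?thesis by (simp add: cos_mode_def)
  qed
  ultimately show ?thesis by simp
qed

section \<open>Uniform density of the span of the sine modes\<close>

definition sin_mode_span :: "(real \<Rightarrow> real) set" where
  "sin_mode_span = {f. \<exists>N a. \<forall>v. f v = (\<Sum>k<N. a k * sin_mode k v)}"

lemma sin_mode_spanI: "(\<And>v. f v = (\<Sum>k<N. a k * sin_mode k v)) \<Longrightarrow> f \<in> sin_mode_span"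
  unfolding sin_mode_span_def by blast

lemma sin_mode_span_base: "sin_mode k \<in> sin_mode_span"
proof -
  have "sin_mode k v = (\<Sum>j<Suc k. (if j = k then 1 else 0) * sin_mode j v)" for v
    by (simp add: if_distrib[of "\<lambda>x. x * _"] cong: if_cong)
  then show ?thesis by (rule sin_mode_spanI)
qed

lemma sin_mode_span_scale:
  assumes "f \<in> sin_mode_span"
  shows "(\<lambda>v. c * f v) \<in> sin_mode_span"
proof -
  from assms obtain N a where "\<forall>v. f v = (\<Sum>k<N. a k * sin_mode k v)"
    unfolding sin_mode_span_def by blast
  then have "c * f v = (\<Sum>k<N. (c * a k) * sin_mode k v)" for v
    by (simp add: sum_distrib_left mult.assoc)
  then show ?thesis by (rule sin_mode_spanI)
qed

lemma sin_mode_span_add: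
  assumes "f \<in> sin_mode_span" "g \<in> sin_mode_span"
  shows "(\<lambda>v. f v + g v) \<in> sin_mode_span"
proof -
  from assms obtain N a N' b where f: "\<And>v. f v = (\<Sum>k<N. a k * sin_mode k v)"
    and g: "\<And>v. g v = (\<Sum>k<N'. b k * sin_mode k v)"
    unfolding sin_mode_span_def by blast
  have pad: "(\<Sum>k<n. c k * sin_mode k v) = (\<Sum>k<max N N'. (if k < n then c k else 0) * sin_mode k v)"
    if "n \<le> max N N'" for n c v
    using that by (intro sum.mono_neutral_cong_left) auto
  have "f v + g v = (\<Sum>k<max N N'. ((if k < N then a k else 0) + (if k < N' then b k else 0)) * sin_mode k v)" for v
    by (simp add: f g pad[of N] pad[of N'] distrib_right sum.distrib)
  then show ?thesis by (rule sin_mode_spanI)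
qed

lemma sin_mode_span_sum:
  assumes "finite I" "\<And>i. i \<in> I \<Longrightarrow> f i \<in> sin_mode_span"
  shows "(\<lambda>v. \<Sum>i\<in>I. f i v) \<in> sin_mode_span"
  using assms
proof (induction rule: finite_induct)
  case empty
  show ?case using sin_mode_span_scale[OF sin_mode_span_base, of 0] by simp
next
  case (insert i I)
  then show ?case by (auto intro!: sin_mode_span_add)
qed

text \<open>Since sin^2 (\<pi> v / 2) = (1 - cos (\<pi> v)) / 2, the multiplication only mixes a
  mode with its two neighbours. This is the induction step that produces all odd powers of sin
  (\<pi> v / 2).\<close>

lemma sin_mode_span_mult_sin_sq:
  assumes "f \<in> sin_mode_span"
  shows "(\<lambda>v. (sin (pi / 2 * v))\<^sup>2 * f v) \<in> sin_mode_span"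
proof -
  have id: "(sin (pi / 2 * v))\<^sup>2 * sin_mode k v =
      1/2 * sin_mode k v + (- 1/4 * sin_mode (Suc k) v + (if k = 0 then 1/4 else -1/4) * sin_mode (k - 1) v)" for k v
  proof -
    define x where "x = (real k + 1/2) * pi * v"
    have up: "(real (Suc k) + 1/2) * pi * v = x + pi * v"
      by (simp add: x_def algebra_simps)
    \<comment> \<open>For k = 0 the lower neighbour has frequency - 1/2, which is minus mode 0
      itself. The truncated difference k - 1 = 0 names that mode, and the sign flips to 1/4.\<close>
    have down: "(if k = 0 then 1/4 else -1/4) * sin ((real (k - 1) + 1/2) * pi * v) = - 1/4 * sin (x - pi * v)"
    proof (cases "k = 0")
      case True
      have "x - pi * v = - (1/2 * pi * v)"
        by (simp add: x_def True algebra_simps)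
      with True show ?thesis by (simp only: sin_minus) simp
    next
      case False
      then have "(real (k - 1) + 1/2) * pi * v = x - pi * v"
        by (simp add: x_def of_nat_diff algebra_simps)
      with False show ?thesis by simp
    qed
    have "(sin (pi / 2 * v))\<^sup>2 = 1/2 - 1/2 * cos (pi * v)"
      using cos_double_sin[of "pi / 2 * v"] by (simp add: field_simps)
    moreover have "(1/2 - 1/2 * cos (pi * v)) * sin x =
        1/2 * sin x - 1/4 * sin (x + pi * v) - 1/4 * sin (x - pi * v)"
      by (simp add: sin_add sin_diff algebra_simps)
    ultimately have "(sin (pi / 2 * v))\<^sup>2 * sin x =
        1/2 * sin x - 1/4 * sin (x + pi * v) - 1/4 * sin (x - pi * v)"
      by simp
    with down have "(sin (pi / 2 * v))\<^sup>2 * sin x = 1/2 * sin x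
        + (- 1/4 * sin (x + pi * v) + (if k = 0 then 1/4 else -1/4) * sin ((real (k - 1) + 1/2) * pi * v))"
      by simp
    then have "sqrt 2 * ((sin (pi / 2 * v))\<^sup>2 * sin x) = sqrt 2 * (1/2 * sin x
        + (- 1/4 * sin (x + pi * v) + (if k = 0 then 1/4 else -1/4) * sin ((real (k - 1) + 1/2) * pi * v)))"
      by simp
    then show ?thesis
      unfolding sin_mode_def up x_def[symmetric] by (simp only: algebra_simps)
  qed
  from assms obtain N a where f: "\<And>v. f v = (\<Sum>k<N. a k * sin_mode k v)"
    unfolding sin_mode_span_def by blast
  have "(\<lambda>v. \<Sum>k<N. a k * (1/2 * sin_mode k v + (- 1/4 * sin_mode (Suc k) v
      + (if k = 0 then 1/4 else -1/4) * sin_mode (k - 1) v))) \<in> sin_mode_span"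
    by (intro sin_mode_span_sum sin_mode_span_scale sin_mode_span_add sin_mode_span_base) simp
  also have "(\<lambda>v. \<Sum>k<N. a k * (1/2 * sin_mode k v + (- 1/4 * sin_mode (Suc k) v
      + (if k = 0 then 1/4 else -1/4) * sin_mode (k - 1) v))) = (\<lambda>v. (sin (pi / 2 * v))\<^sup>2 * f v)"
    unfolding f sum_distrib_left id[symmetric] by (simp add: mult.left_commute)
  finally show ?thesis .
qed

lemma sin_odd_power_in_span: "(\<lambda>v. sin (pi / 2 * v) ^ (2 * m + 1)) \<in> sin_mode_span"
proof (induction m)
  case 0
  have "(\<lambda>v. sin (pi / 2 * v) ^ (2 * 0 + 1)) = (\<lambda>v. 1 / sqrt 2 * sin_mode 0 v)"
    by (simp add: sin_mode_def fun_eq_iff)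
  then show ?case
    by (simp only: sin_mode_span_scale sin_mode_span_base)
next
  case (Suc m)
  have "(\<lambda>v. sin (pi / 2 * v) ^ (2 * Suc m + 1)) = (\<lambda>v. (sin (pi / 2 * v))\<^sup>2 * sin (pi / 2 * v) ^ (2 * m + 1))"
    by (simp add: fun_eq_iff power2_eq_square mult_ac)
  then show ?case
    using sin_mode_span_mult_sin_sq[OF Suc] by simp
qed

text \<open>In the variable \<open>x = sin (\<pi> v / 2)\<close> the span of the modes is the space of odd polynomials, so
  the Weierstrass theorem applies to the odd extension of \<open>w\<close>.\<close>

lemma sin_mode_span_dense:
  fixes w :: "real \<Rightarrow> real"
  assumes cont: "continuous_on {0..1} w" and "w 0 = 0" and "e > 0"
  obtains p where "p \<in> sin_mode_span" "\<And>v. v \<in> {0..1} \<Longrightarrow> \<bar>w v - p v\<bar> < e"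
proof -
  define F where "F x = (if x \<in> {0..1} then w (2 / pi * arcsin x) else - w (2 / pi * arcsin (- x)))" for x
  have arcsin_range: "2 / pi * arcsin x \<in> {0..1}" if "x \<in> {0..1}" for x
  proof -
    have "0 \<le> arcsin x" "arcsin x \<le> pi / 2"
      using that arcsin_le_arcsin[of 0 x] arcsin_bounded[of x] by auto
    then show ?thesis by (auto simp: field_simps)
  qed
  have c1: "continuous_on {0..1} (\<lambda>x. w (2 / pi * arcsin x))"
    using arcsin_range
    by (intro continuous_on_compose2[OF cont] continuous_intros) auto
  have c2: "continuous_on {-1..0} (\<lambda>x. - w (2 / pi * arcsin (- x)))"
    by (intro continuous_intros continuous_on_compose2[OF c1]) auto
  \<comment> \<open>The two branches meet only at 0, where \<open>w 0 = 0\<close> makes them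
    agree.\<close>
  have "continuous_on ({0..1} \<union> {-1..0}) F"
    unfolding F_def using c1 c2 \<open>w 0 = 0\<close>
    by (intro continuous_on_If) (auto simp: antisym)
  moreover have "{0..1} \<union> {-1..0} = {-1..1::real}" by auto
  ultimately have "continuous_on {-1..1} F" by simp
  from Stone_Weierstrass_real_polynomial_function[OF compact_Icc this \<open>e > 0\<close>]
  obtain q where q: "real_polynomial_function q" "\<And>x. x \<in> {-1..1} \<Longrightarrow> \<bar>F x - q x\<bar> < e"
    by blast
  then obtain a n where qa: "q = (\<lambda>x. \<Sum>i\<le>n. a i * x ^ i)"
    unfolding real_polynomial_function_iff_sum by blast
  \<comment> \<open>The odd part of q. Since F is odd, the error of p at x is half the difference of
    the errors of q at x and - x, so it stays below e.\<close>
  define p where "p v = (\<Sum>i\<in>{i. i \<le> n \<and> odd i}. a i * sin (pi / 2 * v) ^ i)" for v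
  have p_odd_part: "p v = (q (sin (pi / 2 * v)) - q (- sin (pi / 2 * v))) / 2" for v
  proof -
    have "(q (sin (pi / 2 * v)) - q (- sin (pi / 2 * v))) / 2
      = (\<Sum>i\<le>n. a i * ((sin (pi / 2 * v) ^ i - (- sin (pi / 2 * v)) ^ i) / 2))"
      unfolding qa by (simp add: sum_subtractf[symmetric] sum_divide_distrib algebra_simps diff_divide_distrib)
    also have "\<dots> = p v"
      unfolding p_def by (intro sum.mono_neutral_cong_right) auto
    finally show ?thesis ..
  qed
  show ?thesis
  proof (rule that)
    have "(\<lambda>v. a i * sin (pi / 2 * v) ^ i) \<in> sin_mode_span" if "odd i" for i
      using that sin_mode_span_scale[OF sin_odd_power_in_span] by (auto elim!: oddE)
    then show "p \<in> sin_mode_span"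
      unfolding p_def by (intro sin_mode_span_sum) auto
    fix v :: real assume v: "v \<in> {0..1}"
    define x where "x = sin (pi / 2 * v)"
    have range: "0 \<le> pi / 2 * v" "pi / 2 * v \<le> pi / 2"
      using v by (auto simp: mult_left_le)
    then have lower: "- (pi / 2) \<le> pi / 2 * v"
      using pi_gt_zero by linarith
    then have x: "x \<in> {0..1}"
      unfolding x_def atLeastAtMost_iff using range pi_gt_zero
      by (intro conjI sin_ge_zero sin_le_one) linarith+
    have "2 / pi * arcsin x = v"
      unfolding x_def by (subst arcsin_sin[OF lower range(2)]) simp
    then have "F x = w v" "F (- x) = - w v"
      using x \<open>w 0 = 0\<close> by (auto simp: F_def)
    moreover have "\<bar>F x - q x\<bar> < e" "\<bar>F (- x) - q (- x)\<bar> < e"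
      using x by (intro q(2); auto)+
    ultimately show "\<bar>w v - p v\<bar> < e"
      unfolding p_odd_part x_def[symmetric] by (simp add: abs_less_iff) argo
  qed
qed

text \<open>Orthonormality and completing the square. The coefficients are left arbitrary because
  two choices are needed: a = c gives Bessel's inequality, and the coefficients of a uniform
  approximation give the reverse bound.\<close>

lemma integral_square_diff_sin_mode_sum:
  fixes w :: "real \<Rightarrow> real" and a :: "nat \<Rightarrow> real"
  assumes cont: "continuous_on {0..1} w"
  defines "c \<equiv> \<lambda>k. integral {0..1} (\<lambda>v. w v * sin_mode k v)"
  shows "integral {0..1} (\<lambda>v. (w v - (\<Sum>k<N. a k * sin_mode k v))\<^sup>2)
    = integral {0..1} (\<lambda>v. (w v)\<^sup>2) - (\<Sum>k<N. (c k)\<^sup>2) + (\<Sum>k<N. (a k - c k)\<^sup>2)"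
proof -
  have w2: "((\<lambda>v. (w v)\<^sup>2) has_integral integral {0..1} (\<lambda>v. (w v)\<^sup>2)) {0..1}"
    by (intro integrable_integral integrable_continuous_real continuous_intros cont)
  have wc: "((\<lambda>v. w v * sin_mode k v) has_integral c k) {0..1}" for k
    unfolding c_def by (intro integrable_integral integrable_continuous_real continuous_intros cont)
  have "((\<lambda>v. (w v)\<^sup>2 - (\<Sum>k<N. 2 * a k * (w v * sin_mode k v))
      + (\<Sum>k<N. \<Sum>j<N. a k * a j * (sin_mode k v * sin_mode j v))) has_integral
      integral {0..1} (\<lambda>v. (w v)\<^sup>2) - (\<Sum>k<N. 2 * a k * c k)
        + (\<Sum>k<N. \<Sum>j<N. a k * a j * (if k = j then 1 else 0))) {0..1}"
    by (intro has_integral_add has_integral_diff has_integral_sum has_integral_mult_right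
        w2 wc has_integral_sin_mode_mult) auto
  moreover have "(w v)\<^sup>2 - (\<Sum>k<N. 2 * a k * (w v * sin_mode k v))
      + (\<Sum>k<N. \<Sum>j<N. a k * a j * (sin_mode k v * sin_mode j v)) = (w v - (\<Sum>k<N. a k * sin_mode k v))\<^sup>2" for v
  proof -
    have "(\<Sum>k<N. \<Sum>j<N. a k * a j * (sin_mode k v * sin_mode j v))
        = (\<Sum>k<N. a k * sin_mode k v) * (\<Sum>k<N. a k * sin_mode k v)"
      by (simp only: sum_product mult_ac)
    moreover have "(\<Sum>k<N. 2 * a k * (w v * sin_mode k v)) = 2 * w v * (\<Sum>k<N. a k * sin_mode k v)"
      by (simp only: sum_distrib_left mult_ac)
    ultimately show ?thesis by (simp add: power2_eq_square algebra_simps)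
  qed
  moreover have "(\<Sum>k<N. \<Sum>j<N. a k * a j * (if k = j then 1 else 0)) = (\<Sum>k<N. (a k)\<^sup>2)"
    by (intro sum.cong refl) (simp add: power2_eq_square if_distrib cong: if_cong)
  ultimately have "integral {0..1} (\<lambda>v. (w v - (\<Sum>k<N. a k * sin_mode k v))\<^sup>2)
      = integral {0..1} (\<lambda>v. (w v)\<^sup>2) - (\<Sum>k<N. 2 * a k * c k) + (\<Sum>k<N. (a k)\<^sup>2)"
    by (simp only: integral_unique)
  then show ?thesis
    by (simp add: power2_diff sum.distrib sum_subtractf mult_ac)
qed

lemma sin_mode_Parseval:
  fixes w :: "real \<Rightarrow> real"
  assumes cont: "continuous_on {0..1} w" and "w 0 = 0"
  shows "(\<lambda>k. (integral {0..1} (\<lambda>v. w v * sin_mode k v))\<^sup>2) sums integral {0..1} (\<lambda>v. (w v)\<^sup>2)"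
proof -
  define c where "c k = integral {0..1} (\<lambda>v. w v * sin_mode k v)" for k
  define I where "I = integral {0..1} (\<lambda>v. (w v)\<^sup>2)"
  have diff: "integral {0..1} (\<lambda>v. (w v - (\<Sum>k<N. a k * sin_mode k v))\<^sup>2)
    = I - (\<Sum>k<N. (c k)\<^sup>2) + (\<Sum>k<N. (a k - c k)\<^sup>2)" for N a
    unfolding I_def c_def by (rule integral_square_diff_sin_mode_sum[OF cont])
  have upper: "(\<Sum>k<N. (c k)\<^sup>2) \<le> I" for N
  proof -
    have "0 \<le> integral {0..1} (\<lambda>v. (w v - (\<Sum>k<N. c k * sin_mode k v))\<^sup>2)"
      by (rule integral_nonneg) (auto intro!: integrable_continuous_real continuous_intros cont)
    then show ?thesis by (simp add: diff)
  qed
  have lower: "\<exists>N. I - e < (\<Sum>k<N. (c k)\<^sup>2)" if "e > 0" for e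
  proof -
    \<comment> \<open>A uniform error d on the unit interval costs at most d^2 = e / 2 in the
      squared norm.\<close>
    define d where "d = sqrt (e / 2)"
    have "d > 0" using that by (simp add: d_def)
    obtain p where p: "p \<in> sin_mode_span" "\<And>v. v \<in> {0..1} \<Longrightarrow> \<bar>w v - p v\<bar> < d"
      using sin_mode_span_dense[OF assms \<open>d > 0\<close>] by blast
    then obtain N a where pa: "p = (\<lambda>v. \<Sum>k<N. a k * sin_mode k v)"
      unfolding sin_mode_span_def by blast
    have "integral {0..1} (\<lambda>v. (w v - p v)\<^sup>2) \<le> integral {0..1} (\<lambda>v::real. d\<^sup>2)"
    proof (rule integral_le)
      show "(\<lambda>v. (w v - p v)\<^sup>2) integrable_on {0..1}"
        unfolding pa by (auto intro!: integrable_continuous_real continuous_intros cont)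
      show "(w v - p v)\<^sup>2 \<le> d\<^sup>2" if "v \<in> {0..1}" for v
        using p(2)[OF that] \<open>d > 0\<close> by (intro abs_le_square_iff[THEN iffD1]) auto
    qed (rule integrable_const_ivl)
    also have "\<dots> = e / 2" using that by (simp add: d_def)
    finally have "I - (\<Sum>k<N. (c k)\<^sup>2) + (\<Sum>k<N. (a k - c k)\<^sup>2) \<le> e / 2"
      unfolding pa diff .
    moreover have "0 \<le> (\<Sum>k<N. (a k - c k)\<^sup>2)" by (intro sum_nonneg) simp
    ultimately show ?thesis using that by (intro exI[of _ N]) linarith
  qed
  have mono: "(\<Sum>k<m. (c k)\<^sup>2) \<le> (\<Sum>k<n. (c k)\<^sup>2)" if "m \<le> n" for m n
    using that by (intro sum_mono2) auto
  have "(\<lambda>N. \<Sum>k<N. (c k)\<^sup>2) \<longlonglongrightarrow> I"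
  proof (rule LIMSEQ_I)
    fix e :: real assume "0 < e"
    with lower obtain N where "I - e < (\<Sum>k<N. (c k)\<^sup>2)" by blast
    with mono upper have "norm ((\<Sum>k<n. (c k)\<^sup>2) - I) < e" if "n \<ge> N" for n
      using that by (smt (verit, ccfv_threshold) real_norm_def)
    then show "\<exists>no. \<forall>n\<ge>no. norm ((\<Sum>k<n. (c k)\<^sup>2) - I) < e" by blast
  qed
  then show ?thesis unfolding sums_def c_def I_def .
qed

subsection \<open>Independence from joint characteristic functions\<close>

text \<open>Under the probability measure with density W / E, where E is the mean of W, the
  hypothesis says that X has the characteristic function of N; Levy's theorem then gives the law of
  X under this measure. Information about the other variables is carried by the weight.\<close>

lemma (in prob_space) weighted_char_unique:
  fixes X W :: "'a \<Rightarrow> real"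
  assumes [measurable]: "random_variable borel X" "W \<in> borel_measurable M" "A \<in> sets borel"
    and W: "\<And>\<omega>. 0 \<le> W \<omega>" "\<And>\<omega>. W \<omega> \<le> C"
    and N: "real_distribution N"
    and char: "\<And>t. (CLINT \<omega>|M. of_real (W \<omega>) * iexp (t * X \<omega>)) = of_real (expectation W) * char N t"
  shows "expectation (\<lambda>\<omega>. W \<omega> * indicator A (X \<omega>)) = expectation W * measure N A"
proof (cases "expectation W = 0")
  \<comment> \<open>A weight of mean 0 cannot be normalized to a density, but then both sides are
    squeezed to 0.\<close>
  case True
  have int: "integrable M W"
    using W by (intro integrable_const_bound[where B = C]) auto
  then have "integrable M (\<lambda>\<omega>. W \<omega> * indicator A (X \<omega>))"
    by (rule Bochner_Integration.integrable_bound) (use W in \<open>auto simp: indicator_def\<close>)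
  then have "expectation (\<lambda>\<omega>. W \<omega> * indicator A (X \<omega>)) \<le> expectation W"
    using int W by (intro integral_mono) (auto simp: indicator_def)
  moreover have "0 \<le> expectation (\<lambda>\<omega>. W \<omega> * indicator A (X \<omega>))"
    using W by (intro integral_nonneg_AE) (auto simp: indicator_def)
  ultimately show ?thesis using True by simp
next
  case False
  define E where "E = expectation W"
  have int: "integrable M W"
    using W by (intro integrable_const_bound[where B = C]) auto
  have "E > 0"
    using False integral_nonneg_AE[of W M] W by (auto simp: E_def less_le)
  define D where "D = density M (\<lambda>\<omega>. ennreal (W \<omega> / E))"
  have "prob_space D"
  proof
    have "emeasure D (space D) = (\<integral>\<^sup>+\<omega>. ennreal (W \<omega> / E) \<partial>M)"
      unfolding D_def by (subst emeasure_density) (auto intro!: nn_integral_cong)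
    also have "\<dots> = ennreal (expectation (\<lambda>\<omega>. W \<omega> / E))"
      using W int \<open>E > 0\<close> by (intro nn_integral_eq_integral) auto
    also have "expectation (\<lambda>\<omega>. W \<omega> / E) = 1"
      using \<open>E > 0\<close> by (simp add: E_def)
    finally show "emeasure D (space D) = 1" by simp
  qed
  then interpret D: prob_space D .
  have [measurable]: "X \<in> borel_measurable D" by (simp add: D_def)
  have "char (distr D borel X) = char N"
  proof
    fix t
    have "char (distr D borel X) t = (CLINT \<omega>|D. iexp (t * X \<omega>))"
      unfolding char_def by (subst integral_distr) auto
    also have "\<dots> = (CLINT \<omega>|M. (W \<omega> / E) *\<^sub>R iexp (t * X \<omega>))"
      unfolding D_def using W \<open>E > 0\<close> by (subst integral_density) auto
    also have "\<dots> = (CLINT \<omega>|M. of_real (1 / E) * (of_real (W \<omega>) * iexp (t * X \<omega>)))"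
      by (simp add: scaleR_conv_of_real)
    also have "\<dots> = of_real (1 / E) * (CLINT \<omega>|M. of_real (W \<omega>) * iexp (t * X \<omega>))"
      by (rule integral_mult_right_zero)
    also have "\<dots> = char N t"
      unfolding char E_def[symmetric] using \<open>E > 0\<close> by simp
    finally show "char (distr D borel X) t = char N t" .
  qed
  with N have distr: "distr D borel X = N"
    by (intro Levy_uniqueness D.real_distribution_distr) auto
  have "measure N A = measure D (X -` A \<inter> space D)"
    unfolding distr[symmetric] by (subst measure_distr) auto
  also have "\<dots> = D.expectation (indicator (X -` A \<inter> space D))"
    by simp
  also have "\<dots> = D.expectation (\<lambda>\<omega>. indicator A (X \<omega>))"
    by (intro Bochner_Integration.integral_cong) (auto simp: indicator_def)
  also have "\<dots> = expectation (\<lambda>\<omega>. (W \<omega> / E) *\<^sub>R indicator A (X \<omega>))"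
    unfolding D_def using W \<open>E > 0\<close> by (subst integral_density) auto
  also have "\<dots> = expectation (\<lambda>\<omega>. W \<omega> * indicator A (X \<omega>)) / E"
    by (subst Bochner_Integration.integral_divide_zero[symmetric]) simp
  finally show ?thesis using \<open>E > 0\<close> by (simp add: E_def)
qed

text \<open>The phase \<open>exp (i \<Theta>)\<close> is reduced to the nonnegative weights \<open>1 + cos \<Theta>\<close> and \<open>1 + sin \<Theta>\<close>.\<close>

lemma (in prob_space) char_factor_imp_indicator_factor:
  fixes X Z \<Theta> :: "'a \<Rightarrow> real"
  assumes [measurable]: "random_variable borel X" "Z \<in> borel_measurable M" "random_variable borel \<Theta>" "A \<in> sets borel"
    and Z: "\<And>\<omega>. 0 \<le> Z \<omega>" "\<And>\<omega>. Z \<omega> \<le> 1"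
    and N: "real_distribution N"
    and char: "\<And>s \<sigma>. \<sigma> \<in> {-1, 0, 1} \<Longrightarrow>
      (CLINT \<omega>|M. of_real (Z \<omega>) * iexp (s * X \<omega> + \<sigma> * \<Theta> \<omega>))
        = char N s * (CLINT \<omega>|M. of_real (Z \<omega>) * iexp (\<sigma> * \<Theta> \<omega>))"
  shows "(CLINT \<omega>|M. of_real (Z \<omega> * indicator A (X \<omega>)) * iexp (\<Theta> \<omega>))
    = of_real (measure N A) * (CLINT \<omega>|M. of_real (Z \<omega>) * iexp (\<Theta> \<omega>))"
proof -
  have Zi: "integrable M (\<lambda>\<omega>. of_real (Z \<omega>) * f \<omega>)"
    if [measurable]: "f \<in> borel_measurable M" and "\<And>\<omega>. cmod (f \<omega>) \<le> 1" for f :: "'a \<Rightarrow> complex"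
    by (intro integrable_const_bound[where B = 1])
       (use Z that in \<open>auto simp: norm_mult intro!: mult_le_one\<close>)
  have Zr: "integrable M (\<lambda>\<omega>. Z \<omega> * f \<omega>)"
    if [measurable]: "f \<in> borel_measurable M" and "\<And>\<omega>. \<bar>f \<omega>\<bar> \<le> C" for f :: "'a \<Rightarrow> real" and C
  proof -
    have "0 \<le> C" using that(2)[of undefined] by linarith
    have "norm (Z \<omega> * f \<omega>) \<le> 1 * C" for \<omega>
      unfolding real_norm_def abs_mult using Z that \<open>0 \<le> C\<close> by (intro mult_mono) auto
    then show ?thesis by (intro integrable_const_bound[where B = "1 * C"]) auto
  qed
  \<comment> \<open>Here g stands for 0, cos \<Theta> or sin \<Theta>. Each is a combination of exp
    (i \<Theta>) and exp (- i \<Theta>), so the hypothesis is required only for the phase multiples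
    -1, 0 and 1.\<close>
  have trig: "expectation (\<lambda>\<omega>. Z \<omega> * (1 + g \<omega>) * indicator A (X \<omega>)) = expectation (\<lambda>\<omega>. Z \<omega> * (1 + g \<omega>)) * measure N A"
    if [measurable]: "g \<in> borel_measurable M" and g: "\<And>\<omega>. \<bar>g \<omega>\<bar> \<le> 1"
      and cg: "\<And>\<omega>. complex_of_real (g \<omega>) = p * iexp (\<Theta> \<omega>) + q * iexp (- \<Theta> \<omega>)"
    for g :: "'a \<Rightarrow> real" and p q :: complex
  proof (rule weighted_char_unique[where C = 2])
    show "0 \<le> Z \<omega> * (1 + g \<omega>)" for \<omega>
      using Z[of \<omega>] g[of \<omega>] by (intro mult_nonneg_nonneg) auto
    have "Z \<omega> * (1 + g \<omega>) \<le> 1 * 2" for \<omega>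
      using Z[of \<omega>] g[of \<omega>] by (intro mult_mono) auto
    then show "Z \<omega> * (1 + g \<omega>) \<le> 2" for \<omega> by simp
    define G where "G s \<sigma> = (CLINT \<omega>|M. of_real (Z \<omega>) * iexp (s * X \<omega> + \<sigma> * \<Theta> \<omega>))" for s \<sigma>
    have split: "(CLINT \<omega>|M. of_real (Z \<omega> * (1 + g \<omega>)) * iexp (s * X \<omega>)) = G s 0 + p * G s 1 + q * G s (-1)" for s
    proof -
      have "of_real (Z \<omega> * (1 + g \<omega>)) * iexp (s * X \<omega>) =
          of_real (Z \<omega>) * iexp (s * X \<omega> + 0 * \<Theta> \<omega>) + p * (of_real (Z \<omega>) * iexp (s * X \<omega> + 1 * \<Theta> \<omega>))
          + q * (of_real (Z \<omega>) * iexp (s * X \<omega> + (-1) * \<Theta> \<omega>))" for \<omega>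
      proof -
        have e: "iexp (s * X \<omega> + 1 * \<Theta> \<omega>) = iexp (s * X \<omega>) * iexp (\<Theta> \<omega>)"
          "iexp (s * X \<omega> + (-1) * \<Theta> \<omega>) = iexp (s * X \<omega>) * iexp (- \<Theta> \<omega>)"
          by (simp_all only: mult_1_left mult_minus1 of_real_add distrib_left exp_add)
        show ?thesis unfolding e by (simp add: cg algebra_simps)
      qed
      then have "(CLINT \<omega>|M. of_real (Z \<omega> * (1 + g \<omega>)) * iexp (s * X \<omega>)) =
          (CLINT \<omega>|M. of_real (Z \<omega>) * iexp (s * X \<omega> + 0 * \<Theta> \<omega>) + p * (of_real (Z \<omega>) * iexp (s * X \<omega> + 1 * \<Theta> \<omega>))
          + q * (of_real (Z \<omega>) * iexp (s * X \<omega> + (-1) * \<Theta> \<omega>)))"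
        by simp
      also have "\<dots> = G s 0 + p * G s 1 + q * G s (-1)"
        unfolding G_def
        by (subst Bochner_Integration.integral_add Bochner_Integration.integral_mult_right_zero
            | intro Bochner_Integration.integrable_add integrable_mult_right Zi; simp)+ (rule refl)
      finally show ?thesis .
    qed
    have Gf: "G s \<sigma> = char N s * G 0 \<sigma>" if "\<sigma> \<in> {-1, 0, 1}" for s \<sigma>
      using char[OF that, of s] by (simp add: G_def)
    have "of_real (expectation (\<lambda>\<omega>. Z \<omega> * (1 + g \<omega>))) = (CLINT \<omega>|M. of_real (Z \<omega> * (1 + g \<omega>)) * iexp (0 * X \<omega>))"
      unfolding integral_complex_of_real[symmetric] by simp
    then show "(CLINT \<omega>|M. of_real (Z \<omega> * (1 + g \<omega>)) * iexp (s * X \<omega>))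
        = of_real (expectation (\<lambda>\<omega>. Z \<omega> * (1 + g \<omega>))) * char N s" for s
      unfolding split[of s] split[of 0] using Gf[of 0 s] Gf[of 1 s] Gf[of "-1" s] by (simp add: algebra_simps)
  qed (use N in auto)
  \<comment> \<open>The case g = 0, which is subtracted below to remove the summand 1 that made the
    weights nonnegative.\<close>
  have base: "expectation (\<lambda>\<omega>. Z \<omega> * indicator A (X \<omega>)) = expectation Z * measure N A"
    using trig[of "\<lambda>_. 0" 0 0] by simp
  have drop: "expectation (\<lambda>\<omega>. Z \<omega> * indicator A (X \<omega>) * g \<omega>) = expectation (\<lambda>\<omega>. Z \<omega> * g \<omega>) * measure N A"
    if [measurable]: "g \<in> borel_measurable M" and g: "\<And>\<omega>. \<bar>g \<omega>\<bar> \<le> 1"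
      and cg: "\<And>\<omega>. complex_of_real (g \<omega>) = p * iexp (\<Theta> \<omega>) + q * iexp (- \<Theta> \<omega>)"
    for g :: "'a \<Rightarrow> real" and p q :: complex
  proof -
    have i1: "integrable M (\<lambda>\<omega>. Z \<omega> * indicator A (X \<omega>))" "integrable M Z"
      using Zr[of "\<lambda>\<omega>. indicator A (X \<omega>)" 1] Zr[of "\<lambda>_. 1" 1] by (simp_all add: indicator_def)
    have i2: "integrable M (\<lambda>\<omega>. Z \<omega> * (indicator A (X \<omega>) * g \<omega>))" "integrable M (\<lambda>\<omega>. Z \<omega> * g \<omega>)"
      using Zr[of "\<lambda>\<omega>. indicator A (X \<omega>) * g \<omega>" 1] Zr[of g 1] g by (simp_all add: indicator_def)
    have "expectation (\<lambda>\<omega>. Z \<omega> * indicator A (X \<omega>)) + expectation (\<lambda>\<omega>. Z \<omega> * (indicator A (X \<omega>) * g \<omega>))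
      = expectation (\<lambda>\<omega>. Z \<omega> * (1 + g \<omega>) * indicator A (X \<omega>))"
      by (subst Bochner_Integration.integral_add[symmetric])
         (use i1 i2 in \<open>auto intro!: Bochner_Integration.integral_cong simp: algebra_simps\<close>)
    moreover have "expectation (\<lambda>\<omega>. Z \<omega> * (1 + g \<omega>)) = expectation Z + expectation (\<lambda>\<omega>. Z \<omega> * g \<omega>)"
      by (subst Bochner_Integration.integral_add[symmetric]) (use i1 i2 in \<open>auto simp: algebra_simps\<close>)
    ultimately show ?thesis
      using base trig[OF that] by (simp add: algebra_simps)
  qed
  have cos: "expectation (\<lambda>\<omega>. Z \<omega> * indicator A (X \<omega>) * cos (\<Theta> \<omega>)) = expectation (\<lambda>\<omega>. Z \<omega> * cos (\<Theta> \<omega>)) * measure N A"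
    by (rule drop[of _ "1/2" "1/2"]) (auto simp: cos_exp_eq simp flip: cos_of_real)
  have sin: "expectation (\<lambda>\<omega>. Z \<omega> * indicator A (X \<omega>) * sin (\<Theta> \<omega>)) = expectation (\<lambda>\<omega>. Z \<omega> * sin (\<Theta> \<omega>)) * measure N A"
    by (rule drop[of _ "1/(2*\<i>)" "-1/(2*\<i>)"])
       (auto simp: sin_exp_eq field_simps simp flip: sin_of_real)
  have polar: "(CLINT \<omega>|M. of_real (V \<omega>) * iexp (\<Theta> \<omega>))
      = of_real (expectation (\<lambda>\<omega>. V \<omega> * cos (\<Theta> \<omega>))) + \<i> * of_real (expectation (\<lambda>\<omega>. V \<omega> * sin (\<Theta> \<omega>)))"
    if "integrable M (\<lambda>\<omega>. V \<omega> * cos (\<Theta> \<omega>))" "integrable M (\<lambda>\<omega>. V \<omega> * sin (\<Theta> \<omega>))" for V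
  proof -
    have "(CLINT \<omega>|M. of_real (V \<omega>) * iexp (\<Theta> \<omega>))
        = (CLINT \<omega>|M. of_real (V \<omega> * cos (\<Theta> \<omega>)) + \<i> * of_real (V \<omega> * sin (\<Theta> \<omega>)))"
      by (intro Bochner_Integration.integral_cong refl)
         (simp add: exp_Euler cos_of_real sin_of_real algebra_simps)
    also have "\<dots> = (CLINT \<omega>|M. of_real (V \<omega> * cos (\<Theta> \<omega>))) + (CLINT \<omega>|M. \<i> * of_real (V \<omega> * sin (\<Theta> \<omega>)))"
      using that by (intro Bochner_Integration.integral_add integrable_mult_right integrable_of_real) auto
    finally show ?thesis by (simp only: integral_complex_of_real Bochner_Integration.integral_mult_right_zero)
  qed
  have "integrable M (\<lambda>\<omega>. Z \<omega> * indicator A (X \<omega>) * cos (\<Theta> \<omega>))"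
    "integrable M (\<lambda>\<omega>. Z \<omega> * indicator A (X \<omega>) * sin (\<Theta> \<omega>))"
    using Zr[of "\<lambda>\<omega>. indicator A (X \<omega>) * cos (\<Theta> \<omega>)" 1] Zr[of "\<lambda>\<omega>. indicator A (X \<omega>) * sin (\<Theta> \<omega>)" 1]
    by (auto simp: indicator_def mult.assoc)
  moreover have "integrable M (\<lambda>\<omega>. Z \<omega> * cos (\<Theta> \<omega>))" "integrable M (\<lambda>\<omega>. Z \<omega> * sin (\<Theta> \<omega>))"
    using Zr[of "\<lambda>\<omega>. cos (\<Theta> \<omega>)" 1] Zr[of "\<lambda>\<omega>. sin (\<Theta> \<omega>)" 1] by simp_all
  ultimately show ?thesis
    by (simp only: polar cos sin) (simp add: algebra_simps)
qed

text \<open>Exponentials are traded for indicators one index at a time: a new index first joins the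
  phase, where the induction hypothesis applies, and is then turned into an indicator by the
  preceding lemma. Hence J and t must vary in the induction. With J empty the formula is the product
  rule for events.\<close>

lemma (in prob_space) joint_char_prod_imp_indicator_prod:
  fixes X :: "'i \<Rightarrow> 'a \<Rightarrow> real"
  assumes X: "\<And>i. i \<in> I \<Longrightarrow> random_variable borel (X i)"
    and N: "\<And>i. i \<in> I \<Longrightarrow> real_distribution (N i)"
    and joint: "\<And>J t. finite J \<Longrightarrow> J \<subseteq> I \<Longrightarrow>
      (CLINT \<omega>|M. iexp (\<Sum>j\<in>J. t j * X j \<omega>)) = (\<Prod>j\<in>J. char (N j) (t j))"
    and A: "\<And>i. i \<in> I \<Longrightarrow> A i \<in> sets borel"
    and K: "finite K" "K \<subseteq> I" and J: "finite J" "J \<subseteq> I" "J \<inter> K = {}"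
  shows "(CLINT \<omega>|M. of_real (\<Prod>k\<in>K. indicator (A k) (X k \<omega>)) * iexp (\<Sum>j\<in>J. t j * X j \<omega>))
    = of_real (\<Prod>k\<in>K. measure (N k) (A k)) * (\<Prod>j\<in>J. char (N j) (t j))"
  using K J
proof (induction K arbitrary: J t rule: finite_induct)
  case empty
  then show ?case using joint[of J t] by simp
next
  case (insert k K)
  define Z where "Z \<omega> = (\<Prod>k\<in>K. indicator (A k) (X k \<omega>) :: real)" for \<omega>
  define \<Theta> where "\<Theta> \<omega> = (\<Sum>j\<in>J. t j * X j \<omega>)" for \<omega>
  have IH: "(CLINT \<omega>|M. of_real (Z \<omega>) * iexp (\<Sum>j\<in>L. u j * X j \<omega>))
      = of_real (\<Prod>k\<in>K. measure (N k) (A k)) * (\<Prod>j\<in>L. char (N j) (u j))"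
    if "finite L" "L \<subseteq> I" "L \<inter> K = {}" for L u
    unfolding Z_def using that insert by (intro insert.IH) auto
  have k: "k \<in> I" "k \<notin> J" using insert.prems by auto
  have [measurable]: "Z \<in> borel_measurable M"
    unfolding Z_def using X A insert.prems
    by (intro borel_measurable_prod measurable_compose[OF X borel_measurable_indicator]) auto
  have [measurable]: "\<Theta> \<in> borel_measurable M"
    unfolding \<Theta>_def using X insert.prems by (intro borel_measurable_sum borel_measurable_times) auto
  have Z: "0 \<le> Z \<omega>" "Z \<omega> \<le> 1" for \<omega>
    unfolding Z_def by (auto intro!: prod_nonneg prod_le_1)
  have "(CLINT \<omega>|M. of_real (Z \<omega> * indicator (A k) (X k \<omega>)) * iexp (\<Theta> \<omega>))
    = of_real (measure (N k) (A k)) * (CLINT \<omega>|M. of_real (Z \<omega>) * iexp (\<Theta> \<omega>))"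
  proof (rule char_factor_imp_indicator_factor)
    fix s \<sigma> :: real
    \<comment> \<open>The old phase is scaled by \<sigma> while the new index k gets its own
      frequency s, so both sides of the factorization are instances of the induction
      hypothesis.\<close>
    define u where "u = (\<lambda>j. \<sigma> * t j)(k := s)"
    have "s * X k \<omega> + \<sigma> * \<Theta> \<omega> = (\<Sum>j\<in>insert k J. u j * X j \<omega>)" for \<omega>
    proof -
      have "(\<Sum>j\<in>J. u j * X j \<omega>) = \<sigma> * \<Theta> \<omega>"
        unfolding \<Theta>_def sum_distrib_left using k by (intro sum.cong) (auto simp: u_def)
      then show ?thesis using k insert.prems by (simp add: u_def)
    qed
    moreover have "\<sigma> * \<Theta> \<omega> = (\<Sum>j\<in>J. (\<sigma> * t j) * X j \<omega>)" for \<omega>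
      unfolding \<Theta>_def sum_distrib_left by (simp add: mult.assoc)
    moreover have "(\<Prod>j\<in>insert k J. char (N j) (u j)) = char (N k) s * (\<Prod>j\<in>J. char (N j) (\<sigma> * t j))"
    proof -
      have "(\<Prod>j\<in>J. char (N j) (u j)) = (\<Prod>j\<in>J. char (N j) (\<sigma> * t j))"
        using k by (intro prod.cong) (auto simp: u_def)
      then show ?thesis using k insert.prems by (simp add: u_def)
    qed
    moreover have "(CLINT \<omega>|M. of_real (Z \<omega>) * iexp (\<Sum>j\<in>insert k J. u j * X j \<omega>))
      = of_real (\<Prod>k\<in>K. measure (N k) (A k)) * (\<Prod>j\<in>insert k J. char (N j) (u j))"
      using insert by (intro IH) auto
    moreover have "(CLINT \<omega>|M. of_real (Z \<omega>) * iexp (\<Sum>j\<in>J. (\<sigma> * t j) * X j \<omega>))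
      = of_real (\<Prod>k\<in>K. measure (N k) (A k)) * (\<Prod>j\<in>J. char (N j) (\<sigma> * t j))"
      using insert by (intro IH) auto
    ultimately show "(CLINT \<omega>|M. of_real (Z \<omega>) * iexp (s * X k \<omega> + \<sigma> * \<Theta> \<omega>))
        = char (N k) s * (CLINT \<omega>|M. of_real (Z \<omega>) * iexp (\<sigma> * \<Theta> \<omega>))"
      by (simp only: mult.left_commute)
  qed (use k X N A Z in auto)
  moreover have "(CLINT \<omega>|M. of_real (Z \<omega>) * iexp (\<Theta> \<omega>))
      = of_real (\<Prod>k\<in>K. measure (N k) (A k)) * (\<Prod>j\<in>J. char (N j) (t j))"
    unfolding \<Theta>_def using insert.prems by (intro IH) auto
  moreover have "(\<Prod>k\<in>insert k K. indicator (A k) (X k \<omega>)) = Z \<omega> * indicator (A k) (X k \<omega>)" for \<omega>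
    unfolding Z_def using insert.hyps by (simp add: mult.commute)
  moreover have "(\<Prod>k\<in>insert k K. measure (N k) (A k)) = measure (N k) (A k) * (\<Prod>k\<in>K. measure (N k) (A k))"
    using insert.hyps by simp
  ultimately show ?case
    unfolding \<Theta>_def[symmetric] by (simp only: of_real_mult mult.assoc)
qed

lemma (in prob_space) joint_char_prod_imp_indep_vars:
  fixes X :: "'i \<Rightarrow> 'a \<Rightarrow> real"
  assumes X: "\<And>i. i \<in> I \<Longrightarrow> random_variable borel (X i)"
    and N: "\<And>i. i \<in> I \<Longrightarrow> real_distribution (N i)"
    and joint: "\<And>J t. finite J \<Longrightarrow> J \<subseteq> I \<Longrightarrow>
      (CLINT \<omega>|M. iexp (\<Sum>j\<in>J. t j * X j \<omega>)) = (\<Prod>j\<in>J. char (N j) (t j))"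
  shows "indep_vars (\<lambda>_. borel) X I" and "\<And>i. i \<in> I \<Longrightarrow> distr M borel (X i) = N i"
proof -
  have prob: "prob (\<Inter>j\<in>J. X j -` A j \<inter> space M) = (\<Prod>j\<in>J. measure (N j) (A j))"
    if J: "finite J" "J \<noteq> {}" "J \<subseteq> I" and A: "\<And>j. j \<in> J \<Longrightarrow> A j \<in> sets borel" for J A
  proof -
    \<comment> \<open>The preceding lemma wants Borel sets for all indices in I, but nothing is
      known about A outside J.\<close>
    define A' where "A' j = (if j \<in> J then A j else {})" for j
    have "complex_of_real (prob (\<Inter>j\<in>J. X j -` A j \<inter> space M))
        = of_real (expectation (indicator (\<Inter>j\<in>J. X j -` A j \<inter> space M)))"
      using X A J by (subst Bochner_Integration.integral_indicator) (auto intro!: sets.finite_INT measurable_sets)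
    also have "\<dots> = (CLINT \<omega>|M. of_real (indicator (\<Inter>j\<in>J. X j -` A j \<inter> space M) \<omega>))"
      by simp
    also have "\<dots> = (CLINT \<omega>|M. of_real (\<Prod>k\<in>J. indicator (A' k) (X k \<omega>)) * iexp (\<Sum>j\<in>{}. 0 * X j \<omega>))"
      by (intro Bochner_Integration.integral_cong refl)
         (use J in \<open>auto simp: indicator_def A'_def\<close>)
    also have "\<dots> = of_real (\<Prod>k\<in>J. measure (N k) (A' k)) * (\<Prod>j\<in>{}. char (N j) 0)"
      using X N joint J A by (intro joint_char_prod_imp_indicator_prod[where I = I]) (auto simp: A'_def)
    also have "(\<Prod>k\<in>J. measure (N k) (A' k)) = (\<Prod>k\<in>J. measure (N k) (A k))"
      by (intro prod.cong) (auto simp: A'_def)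
    finally show ?thesis by (simp only: prod.empty mult_1_right of_real_eq_iff)
  qed
  have prob1: "prob (X i -` A \<inter> space M) = measure (N i) A" if "i \<in> I" "A \<in> sets borel" for i A
    using prob[of "{i}" "\<lambda>_. A"] that by simp
  show "indep_vars (\<lambda>_. borel) X I"
    unfolding indep_vars_def2 indep_sets_def
  proof (intro conjI ballI allI impI)
    fix J A assume J: "J \<subseteq> I" "J \<noteq> {}" "finite J" and A: "A \<in> (\<Pi> i\<in>J. {X i -` A \<inter> space M | A. A \<in> sets borel})"
    then have "\<forall>j\<in>J. \<exists>B. A j = X j -` B \<inter> space M \<and> B \<in> sets borel" by (auto simp: Pi_iff)
    then obtain B where B: "\<And>j. j \<in> J \<Longrightarrow> A j = X j -` B j \<inter> space M" "\<And>j. j \<in> J \<Longrightarrow> B j \<in> sets borel"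
      by metis
    have "prob (\<Inter>j\<in>J. A j) = prob (\<Inter>j\<in>J. X j -` B j \<inter> space M)"
      using B(1) by simp
    also have "\<dots> = (\<Prod>j\<in>J. prob (A j))"
      using J B prob[of J B] prob1 by (auto intro!: prod.cong)
    finally show "prob (\<Inter>j\<in>J. A j) = (\<Prod>j\<in>J. prob (A j))" .
  qed (use X in auto)
  show "distr M borel (X i) = N i" if i: "i \<in> I" for i
  proof (rule measure_eqI)
    interpret Ni: real_distribution "N i" using N[OF i] .
    show "sets (distr M borel (X i)) = sets (N i)" by simp
    fix B assume "B \<in> sets (distr M borel (X i))"
    then have B: "B \<in> sets borel" by simp
    have "emeasure (distr M borel (X i)) B = emeasure M (X i -` B \<inter> space M)"
      using X[OF i] B by (rule emeasure_distr)
    then show "emeasure (distr M borel (X i)) B = emeasure (N i) B"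
      using prob1[OF i B] by (simp add: emeasure_eq_measure Ni.emeasure_eq_measure)
  qed
qed

subsection \<open>Karhunen--Loeve expansion\<close>

text \<open>On [0, 1] the number min a a' is the inner product of the indicators of
  \<open>{..a}\<close> and \<open>{..a'}\<close>, so the covariance form is the integral of a
  square.\<close>

lemma has_integral_indicator_sum_square:
  fixes b v :: "nat \<Rightarrow> real"
  assumes "\<And>i. i < n \<Longrightarrow> v i \<in> {0..1}"
  shows "((\<lambda>x. (\<Sum>i<n. b i * indicator {..v i} x)\<^sup>2) has_integral
    (\<Sum>i<n. \<Sum>j<n. b i * b j * min (v i) (v j))) {0..1}"
proof -
  have one: "((\<lambda>x. indicator {..a} x * indicator {..a'} x) has_integral min a a') {0..1::real}"
    if "a \<in> {0..1}" "a' \<in> {0..1}" for a a' :: real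
  proof -
    have "((\<lambda>x. 1) has_integral min a a') {0..min a a'}"
      using has_integral_const_real[of "1::real" 0 "min a a'"] that by simp
    then have "((\<lambda>x. if x \<in> {0..min a a'} then 1 else 0) has_integral min a a') {0..1::real}"
      using that by (subst has_integral_restrict) auto
    then show ?thesis
      by (rule has_integral_eq[rotated]) (auto simp: indicator_def)
  qed
  have "((\<lambda>x. \<Sum>i<n. \<Sum>j<n. b i * b j * (indicator {..v i} x * indicator {..v j} x)) has_integral
    (\<Sum>i<n. \<Sum>j<n. b i * b j * min (v i) (v j))) {0..1}"
    using assms by (intro has_integral_sum has_integral_mult_right one) auto
  moreover have "(\<Sum>i<n. \<Sum>j<n. b i * b j * (indicator {..v i} x * indicator {..v j} x))
      = (\<Sum>i<n. b i * indicator {..v i} x)\<^sup>2" for x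
    unfolding power2_eq_square sum_product by (simp only: mult_ac)
  ultimately show ?thesis by simp
qed

text \<open>As the integral of the square of a single Riemann sum, the double sum needs only the
  pointwise limit of the tail sums and one application of dominated convergence.\<close>

lemma min_double_Riemann_sum_tendsto:
  fixes h :: "real \<Rightarrow> real"
  assumes h: "continuous_on {0..1} h"
  shows "(\<lambda>n. \<Sum>i<Suc n. \<Sum>j<Suc n. (h (real (Suc i) / real (Suc n)) / real (Suc n))
      * (h (real (Suc j) / real (Suc n)) / real (Suc n))
      * min (real (Suc i) / real (Suc n)) (real (Suc j) / real (Suc n)))
    \<longlonglongrightarrow> integral {0..1} (\<lambda>x. (integral {x..1} h)\<^sup>2)"
proof -
  define s where "s n x = (\<Sum>j<Suc n. (h (real (Suc j) / real (Suc n)) / real (Suc n)) * indicator {..real (Suc j) / real (Suc n)} x)" for n x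
  have int: "((\<lambda>x. (s n x)\<^sup>2) has_integral (\<Sum>i<Suc n. \<Sum>j<Suc n. (h (real (Suc i) / real (Suc n)) / real (Suc n))
      * (h (real (Suc j) / real (Suc n)) / real (Suc n))
      * min (real (Suc i) / real (Suc n)) (real (Suc j) / real (Suc n)))) {0..1}" for n
    unfolding s_def by (rule has_integral_indicator_sum_square) auto
  have "bounded (h ` {0..1})"
    using h compact_continuous_image compact_imp_bounded by blast
  then obtain C where C: "\<And>u. u \<in> {0..1} \<Longrightarrow> \<bar>h u\<bar> \<le> C"
    unfolding bounded_iff real_norm_def by blast
  have "0 \<le> C" using C[of 0] by auto
  have bound: "\<bar>s n x\<bar> \<le> C" for n x
  proof -
    have "\<bar>s n x\<bar> \<le> (\<Sum>j<Suc n. C / real (Suc n))"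
      unfolding s_def
    proof (rule order_trans[OF sum_abs], rule sum_mono)
      fix j assume "j \<in> {..<Suc n}"
      then have "\<bar>h (real (Suc j) / real (Suc n))\<bar> \<le> C"
        by (intro C) auto
      then show "\<bar>h (real (Suc j) / real (Suc n)) / real (Suc n) * indicator {..real (Suc j) / real (Suc n)} x\<bar> \<le> C / real (Suc n)"
        using \<open>0 \<le> C\<close> by (auto simp: indicator_def abs_mult divide_right_mono)
    qed
    also have "\<dots> = C" by simp
    finally show ?thesis .
  qed
  have "(\<lambda>n. integral {0..1} (\<lambda>x. (s n x)\<^sup>2)) \<longlonglongrightarrow> integral {0..1} (\<lambda>x. (integral {x..1} h)\<^sup>2)"
  proof (rule dominated_convergence(2))
    show "(\<lambda>x. C\<^sup>2) integrable_on {0..1::real}" by (rule integrable_const_ivl)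
    show "norm ((s n x)\<^sup>2) \<le> C\<^sup>2" for n x
      using bound[of n x] by (simp add: abs_le_square_iff[symmetric])
    show "(\<lambda>n. (s n x)\<^sup>2) \<longlonglongrightarrow> (integral {x..1} h)\<^sup>2" if "x \<in> {0..1}" for x
      unfolding s_def by (intro tendsto_power Riemann_sum_tail_tendsto_integral[OF h that])
  qed (use int in \<open>auto simp: integrable_on_def\<close>)
  then show ?thesis by (simp only: integral_unique[OF int])
qed

text \<open>Abel summation of the Karhunen--Loeve coefficients turns the sine modes, weighted by the
  inverse square roots of the eigenvalues, into the orthonormal cosine modes.\<close>

lemma integral_square_sin_mode_tail:
  fixes t :: "nat \<Rightarrow> real"
  assumes "finite J"
  shows "integral {0..1} (\<lambda>x. (integral {x..1} (\<lambda>v. \<Sum>k\<in>J. t k * ((real k + 1/2) * pi * sin_mode k v)))\<^sup>2)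
    = (\<Sum>k\<in>J. (t k)\<^sup>2)"
proof -
  have tail: "integral {x..1} (\<lambda>v. \<Sum>k\<in>J. t k * ((real k + 1/2) * pi * sin_mode k v)) = (\<Sum>k\<in>J. t k * cos_mode k x)"
    if "x \<in> {0..1}" for x
    using assms that
    by (intro integral_unique has_integral_sum has_integral_mult_right has_integral_sin_mode_tail) auto
  have "integral {0..1} (\<lambda>x. (integral {x..1} (\<lambda>v. \<Sum>k\<in>J. t k * ((real k + 1/2) * pi * sin_mode k v)))\<^sup>2)
    = integral {0..1} (\<lambda>x. \<Sum>k\<in>J. \<Sum>j\<in>J. t k * t j * (cos_mode k x * cos_mode j x))"
  proof (rule integral_cong)
    fix x :: real assume x: "x \<in> {0..1}"
    show "(integral {x..1} (\<lambda>v. \<Sum>k\<in>J. t k * ((real k + 1/2) * pi * sin_mode k v)))\<^sup>2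
      = (\<Sum>k\<in>J. \<Sum>j\<in>J. t k * t j * (cos_mode k x * cos_mode j x))"
      unfolding tail[OF x] power2_eq_square sum_product by (simp only: mult_ac)
  qed
  also have "\<dots> = (\<Sum>k\<in>J. \<Sum>j\<in>J. t k * t j * (if k = j then 1 else 0))"
    using assms by (intro integral_unique has_integral_sum has_integral_mult_right has_integral_cos_mode_mult) auto
  also have "\<dots> = (\<Sum>k\<in>J. (t k)\<^sup>2)"
    using assms by (intro sum.cong refl) (simp add: power2_eq_square if_distrib cong: if_cong)
  finally show ?thesis .
qed

theorem (in prob_space) Karhunen_Loeve_square_integral:
  fixes W :: "real \<Rightarrow> 'a \<Rightarrow> real"
  assumes rv: "\<And>v. v \<in> {0..1} \<Longrightarrow> random_variable borel (W v)"
    and gauss: "\<And>(n::nat) b v. (\<And>i. i < n \<Longrightarrow> v i \<in> {0..1}) \<Longrightarrow>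
      (CLINT \<omega>|M. iexp (\<Sum>i<n. b i * W (v i) \<omega>))
        = of_real (exp (- (\<Sum>i<n. \<Sum>j<n. b i * b j * min (v i) (v j)) / 2))"
    and paths: "AE \<omega> in M. continuous_on {0..1} (\<lambda>v. W v \<omega>)"
    and start: "AE \<omega> in M. W 0 \<omega> = 0"
  shows "\<exists>\<xi> :: nat \<Rightarrow> 'a \<Rightarrow> real. indep_vars (\<lambda>_. borel) \<xi> UNIV \<and> (\<forall>k. random_variable borel (\<xi> k)) \<and>
    (\<forall>k. distr M borel (\<xi> k) = std_normal_distribution) \<and>
    (AE \<omega> in M. (\<lambda>k. 1 / ((real k + 1/2)\<^sup>2 * pi\<^sup>2) * (\<xi> k \<omega>)\<^sup>2) sums integral {0..1} (\<lambda>v. (W v \<omega>)\<^sup>2))"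
proof -
  \<comment> \<open>The inverse square root of the k-th eigenvalue, which gives the coefficient
    variance 1.\<close>
  define c where "c k = (real k + 1/2) * pi" for k
  have "c k > 0" for k unfolding c_def by (intro mult_pos_pos) auto
  then have c_nz: "c k \<noteq> 0" for k by (metis less_irrefl)
  define R where "R n k \<omega> = (\<Sum>j<Suc n. (c k * sin_mode k (real (Suc j) / real (Suc n)) / real (Suc n)) * W (real (Suc j) / real (Suc n)) \<omega>)"
    for n k \<omega>
  \<comment> \<open>A limit of measurable Riemann sums is measurable. Where the limit fails to
    exist, \<open>lim\<close> returns an unspecified value; this is confined to the null set of
    discontinuous paths.\<close>
  define \<xi> where "\<xi> k \<omega> = lim (\<lambda>n. R n k \<omega>)" for k \<omega>
  have R_meas [measurable]: "random_variable borel (R n k)" for n k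
    unfolding R_def by (intro borel_measurable_sum borel_measurable_times borel_measurable_const rv) auto
  have xi_meas [measurable]: "random_variable borel (\<xi> k)" for k
    unfolding \<xi>_def by measurable
  have R_lim: "(\<lambda>n. R n k \<omega>) \<longlonglongrightarrow> c k * integral {0..1} (\<lambda>v. W v \<omega> * sin_mode k v)"
    if cont: "continuous_on {0..1} (\<lambda>v. W v \<omega>)" for k \<omega>
  proof -
    have "(\<lambda>n. \<Sum>j<Suc n. (c k * (W (real (Suc j) / real (Suc n)) \<omega> * sin_mode k (real (Suc j) / real (Suc n)))) / real (Suc n))
       \<longlonglongrightarrow> integral {0..1} (\<lambda>v. c k * (W v \<omega> * sin_mode k v))"
      by (rule Riemann_sum_tendsto_integral_continuous[of "\<lambda>v. c k * (W v \<omega> * sin_mode k v)"])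
         (intro continuous_intros cont)
    then show ?thesis
      unfolding R_def integral_mult_right
      by (simp only: times_divide_eq_left times_divide_eq_right mult_ac)
  qed
  have xi_eq: "\<xi> k \<omega> = c k * integral {0..1} (\<lambda>v. W v \<omega> * sin_mode k v)"
    if "continuous_on {0..1} (\<lambda>v. W v \<omega>)" for k \<omega>
    unfolding \<xi>_def by (rule limI[OF R_lim[OF that]])
  have joint: "(CLINT \<omega>|M. iexp (\<Sum>k\<in>J. t k * \<xi> k \<omega>)) = (\<Prod>k\<in>J. char std_normal_distribution (t k))"
    if "finite J" for J t
  proof -
    define h where "h v = (\<Sum>k\<in>J. t k * ((real k + 1/2) * pi * sin_mode k v))" for v
    have h: "continuous_on {0..1} h"
      unfolding h_def by (intro continuous_intros)
    \<comment> \<open>A combination of Riemann sums on one grid is again a Riemann sum, with weight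
      h, so the Gaussian hypothesis applies to it directly.\<close>
    have comb: "(\<Sum>k\<in>J. t k * R n k \<omega>) =
        (\<Sum>j<Suc n. (h (real (Suc j) / real (Suc n)) / real (Suc n)) * W (real (Suc j) / real (Suc n)) \<omega>)" for n \<omega>
      unfolding R_def h_def c_def sum_distrib_left sum_distrib_right sum_divide_distrib
      by (subst sum.swap) (simp only: times_divide_eq_left times_divide_eq_right mult_ac)
    have "(\<lambda>n. CLINT \<omega>|M. iexp (\<Sum>k\<in>J. t k * R n k \<omega>)) \<longlonglongrightarrow> (CLINT \<omega>|M. iexp (\<Sum>k\<in>J. t k * \<xi> k \<omega>))"
    proof (rule integral_dominated_convergence[where w = "\<lambda>_. 1"])
      show "AE \<omega> in M. (\<lambda>n. iexp (\<Sum>k\<in>J. t k * R n k \<omega>)) \<longlonglongrightarrow> iexp (\<Sum>k\<in>J. t k * \<xi> k \<omega>)"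
        using paths
      proof eventually_elim
        case (elim \<omega>)
        then show ?case
          by (intro tendsto_intros) (simp only: xi_eq R_lim)
      qed
    qed auto
    moreover have "(\<lambda>n. CLINT \<omega>|M. iexp (\<Sum>k\<in>J. t k * R n k \<omega>)) \<longlonglongrightarrow> of_real (exp (- (\<Sum>k\<in>J. (t k)\<^sup>2) / 2))"
    proof -
      have "(CLINT \<omega>|M. iexp (\<Sum>k\<in>J. t k * R n k \<omega>)) = of_real (exp (- (\<Sum>i<Suc n. \<Sum>j<Suc n.
          (h (real (Suc i) / real (Suc n)) / real (Suc n)) * (h (real (Suc j) / real (Suc n)) / real (Suc n))
          * min (real (Suc i) / real (Suc n)) (real (Suc j) / real (Suc n))) / 2))" for n
        unfolding comb
        by (rule gauss[of "Suc n" "\<lambda>j. real (Suc j) / real (Suc n)"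
              "\<lambda>j. h (real (Suc j) / real (Suc n)) / real (Suc n)"]) auto
      \<comment> \<open>The limiting variance has no cross terms, which is exactly what makes the
        joint characteristic function a product.\<close>
      moreover have "integral {0..1} (\<lambda>x. (integral {x..1} h)\<^sup>2) = (\<Sum>k\<in>J. (t k)\<^sup>2)"
        unfolding h_def by (rule integral_square_sin_mode_tail[OF that])
      ultimately show ?thesis
        using min_double_Riemann_sum_tendsto[OF h]
        by (simp only:) (intro tendsto_intros, assumption, simp)
    qed
    ultimately have "(CLINT \<omega>|M. iexp (\<Sum>k\<in>J. t k * \<xi> k \<omega>)) = of_real (exp (- (\<Sum>k\<in>J. (t k)\<^sup>2) / 2))"
      by (rule LIMSEQ_unique)
    also have "- (\<Sum>k\<in>J. (t k)\<^sup>2) / 2 = (\<Sum>k\<in>J. - ((t k)\<^sup>2) / 2)"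
      by (simp add: sum_negf sum_divide_distrib)
    also have "of_real (exp (\<Sum>k\<in>J. - ((t k)\<^sup>2) / 2)) = (\<Prod>k\<in>J. char std_normal_distribution (t k))"
      by (simp only: char_std_normal_distribution exp_sum[OF that] of_real_prod)
    finally show ?thesis .
  qed
  have expansion: "AE \<omega> in M. (\<lambda>k. 1 / ((real k + 1/2)\<^sup>2 * pi\<^sup>2) * (\<xi> k \<omega>)\<^sup>2) sums integral {0..1} (\<lambda>v. (W v \<omega>)\<^sup>2)"
    using paths start
  proof eventually_elim
    case (elim \<omega>)
    have "1 / ((real k + 1/2)\<^sup>2 * pi\<^sup>2) * (\<xi> k \<omega>)\<^sup>2 = (integral {0..1} (\<lambda>v. W v \<omega> * sin_mode k v))\<^sup>2" for k
      using c_nz[of k] unfolding xi_eq[OF elim(1)] power_mult_distrib[symmetric] c_def[symmetric]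
      by (simp add: power_mult_distrib)
    then show ?case
      using sin_mode_Parseval[OF elim] by simp
  qed
  show ?thesis
  proof (intro exI[of _ \<xi>] conjI allI)
    note indep = joint_char_prod_imp_indep_vars[where I = UNIV and X = \<xi> and N = "\<lambda>_. std_normal_distribution",
        OF xi_meas real_dist_normal_dist joint]
    show "indep_vars (\<lambda>_. borel) \<xi> UNIV" by (rule indep(1))
    show "distr M borel (\<xi> k) = std_normal_distribution" for k by (rule indep(2)) auto
  qed (use expansion in auto)
qed

subsection \<open>Characteristic functions of Wiener integrals\<close>

lemma increasing_upto:
  fixes \<tau> :: "nat \<Rightarrow> real"
  assumes "\<forall>i<n. \<tau> i < \<tau> (Suc i)" "p \<le> q" "q \<le> n"
  shows "\<tau> p \<le> \<tau> q"
  using assms(2,3)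
proof (induction q rule: dec_induct)
  case (step q)
  then show ?case using assms(1) by (simp add: less_imp_le order.trans)
qed simp

lemma indicator_Ioc_partition:
  fixes \<tau> :: "nat \<Rightarrow> real"
  assumes "\<forall>i<n. \<tau> i < \<tau> (Suc i)" "p \<le> q" "q \<le> n"
  shows "indicator {\<tau> p<..\<tau> q} s = (\<Sum>i=p..<q. indicator {\<tau> i<..\<tau> (Suc i)} s :: real)"
  using assms(2,3)
proof (induction q rule: dec_induct)
  case (step q)
  have "\<tau> p \<le> \<tau> q" "\<tau> q < \<tau> (Suc q)"
    using increasing_upto[OF assms(1), of p q] assms(1) step by auto
  then have "indicator {\<tau> p<..\<tau> (Suc q)} s = indicator {\<tau> p<..\<tau> q} s + (indicator {\<tau> q<..\<tau> (Suc q)} s :: real)"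
    by (auto simp: indicator_def)
  with step show ?case by simp
qed simp

lemma sum_restrict_interval:
  fixes g :: "nat \<Rightarrow> real"
  assumes "q \<le> n"
  shows "(\<Sum>i<n. (if p \<le> i \<and> i < q then c else 0) * g i) = c * (\<Sum>i=p..<q. g i)"
proof -
  have "(\<Sum>i<n. (if p \<le> i \<and> i < q then c else 0) * g i) = (\<Sum>i=p..<q. c * g i)"
    using assms by (intro sum.mono_neutral_cong_right) auto
  then show ?thesis by (simp add: sum_distrib_left)
qed

text \<open>Intervals of a list may overlap, and independence is available only for successive
  increments. The same coefficients d must serve the function and its integral, so that the variance
  of the integral can be read off from the function.\<close>

lemma step_fun_partition:
  fixes \<tau> :: "nat \<Rightarrow> real"
  assumes mono: "\<forall>i<n. \<tau> i < \<tau> (Suc i)"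
    and grid: "\<forall>a b c. (a, b, c) \<in> set xs \<longrightarrow> (\<exists>p q. p \<le> q \<and> q \<le> n \<and> a = \<tau> p \<and> b = \<tau> q)"
  shows "\<exists>d. (\<forall>s. step_fun xs s = (\<Sum>i<n. d i * indicator {\<tau> i<..\<tau> (Suc i)} s)) \<and>
    (\<forall>\<omega>. step_integral B xs \<omega> = (\<Sum>i<n. d i * (B (\<tau> (Suc i)) \<omega> - B (\<tau> i) \<omega>)))"
  using grid
proof (induction xs)
  case Nil
  show ?case by (rule exI[of _ "\<lambda>_. 0"]) (simp add: step_fun_def step_integral_def)
next
  case (Cons x xs)
  obtain a b c where x: "x = (a, b, c)" by (cases x)
  obtain p q where pq: "p \<le> q" "q \<le> n" "a = \<tau> p" "b = \<tau> q"
    using Cons.prems[rule_format, of a b c] x by auto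
  have "\<exists>d. (\<forall>s. step_fun xs s = (\<Sum>i<n. d i * indicator {\<tau> i<..\<tau> (Suc i)} s)) \<and>
    (\<forall>\<omega>. step_integral B xs \<omega> = (\<Sum>i<n. d i * (B (\<tau> (Suc i)) \<omega> - B (\<tau> i) \<omega>)))"
    using Cons.prems by (intro Cons.IH) auto
  then obtain d where d: "\<And>s. step_fun xs s = (\<Sum>i<n. d i * indicator {\<tau> i<..\<tau> (Suc i)} s)"
    "\<And>\<omega>. step_integral B xs \<omega> = (\<Sum>i<n. d i * (B (\<tau> (Suc i)) \<omega> - B (\<tau> i) \<omega>))"
    by blast
  define d' where "d' i = (if p \<le> i \<and> i < q then c else 0) + d i" for i
  have "step_fun (x # xs) s = (\<Sum>i<n. d' i * indicator {\<tau> i<..\<tau> (Suc i)} s)" for s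
  proof -
    have "step_fun (x # xs) s = c * indicator {\<tau> p<..\<tau> q} s + step_fun xs s"
      by (simp add: step_fun_def x pq)
    then show ?thesis
      using indicator_Ioc_partition[OF mono pq(1,2), of s]
      by (simp add: d d'_def distrib_right sum.distrib sum_restrict_interval[OF pq(2)])
  qed
  moreover have "step_integral B (x # xs) \<omega> = (\<Sum>i<n. d' i * (B (\<tau> (Suc i)) \<omega> - B (\<tau> i) \<omega>))" for \<omega>
  proof -
    have "step_integral B (x # xs) \<omega> = c * (B (\<tau> q) \<omega> - B (\<tau> p) \<omega>) + step_integral B xs \<omega>"
      by (simp add: step_integral_def x pq)
    moreover have "B (\<tau> q) \<omega> - B (\<tau> p) \<omega> = (\<Sum>i=p..<q. B (\<tau> (Suc i)) \<omega> - B (\<tau> i) \<omega>)"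
      using pq(1) by (rule sum_Suc_diff'[symmetric])
    ultimately show ?thesis
      by (simp only: d d'_def distrib_right sum.distrib sum_restrict_interval[OF pq(2)])
  qed
  ultimately show ?case by blast
qed

lemma step_list_grid:
  assumes "\<And>a b c. (a, b, c) \<in> set xs \<Longrightarrow> 0 \<le> a \<and> a \<le> (b::real)"
  shows "\<exists>(\<tau> :: nat \<Rightarrow> real) n. 0 \<le> \<tau> 0 \<and> (\<forall>i<n. \<tau> i < \<tau> (Suc i)) \<and>
    (\<forall>a b c. (a, b, c) \<in> set xs \<longrightarrow> (\<exists>p q. p \<le> q \<and> q \<le> n \<and> a = \<tau> p \<and> b = \<tau> q))"
proof -
  \<comment> \<open>The point 0 keeps the grid nonempty even when the list is empty.\<close>
  define P where "P = insert 0 ((\<lambda>(a, b, c). a) ` set xs \<union> (\<lambda>(a, b, c). b) ` set xs)"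
  define ts where "ts = sorted_list_of_set P"
  have "finite P" unfolding P_def by simp
  then have ts: "set ts = P" "sorted_wrt (<) ts"
    unfolding ts_def by auto
  have "0 < length ts"
    using ts(1) by (auto simp: P_def)
  have nonneg: "0 \<le> x" if "x \<in> P" for x
    using that assms by (force simp: P_def)
  show ?thesis
  proof (rule exI[of _ "\<lambda>i. ts ! i"], rule exI[of _ "length ts - 1"], intro conjI allI impI)
    show "0 \<le> ts ! 0"
      using nonneg ts(1) \<open>0 < length ts\<close> nth_mem by blast
    show "ts ! i < ts ! Suc i" if "i < length ts - 1" for i
      using that ts(2) by (auto simp: sorted_wrt_iff_nth_less)
    fix a b c assume x: "(a, b, c) \<in> set xs"
    then have "a \<in> set ts" "b \<in> set ts"
      unfolding ts(1) P_def by force+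
    then obtain p q where pq: "p < length ts" "q < length ts" "a = ts ! p" "b = ts ! q"
      by (metis in_set_conv_nth)
    have "p \<le> q"
    proof (rule ccontr)
      assume "\<not> p \<le> q"
      then have "ts ! q < ts ! p"
        using ts(2) pq by (auto simp: sorted_wrt_iff_nth_less)
      with assms[OF x] pq show False by simp
    qed
    with pq show "\<exists>p q. p \<le> q \<and> q \<le> length ts - 1 \<and> a = ts ! p \<and> b = ts ! q"
      by (intro exI[of _ p] exI[of _ q]) auto
  qed
qed

lemma integral_partition_step_square:
  fixes \<tau> d :: "nat \<Rightarrow> real"
  assumes mono: "\<forall>i<n. \<tau> i < \<tau> (Suc i)"
  shows "has_bochner_integral lborel (\<lambda>s. (\<Sum>i<n. d i * indicator {\<tau> i<..\<tau> (Suc i)} s)\<^sup>2)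
    (\<Sum>i<n. (d i)\<^sup>2 * (\<tau> (Suc i) - \<tau> i))"
proof -
  have disj: "indicator {\<tau> i<..\<tau> (Suc i)} s * indicator {\<tau> j<..\<tau> (Suc j)} s
      = (if i = j then indicator {\<tau> i<..\<tau> (Suc i)} s else (0::real))"
    if "i < n" "j < n" for i j s
  proof -
    have "s \<notin> {\<tau> j<..\<tau> (Suc j)}" if "s \<in> {\<tau> i<..\<tau> (Suc i)}" "i < j" "j < n" for i j
      using that increasing_upto[OF mono, of "Suc i" j] by auto
    with that show ?thesis
      by (cases i j rule: linorder_cases) (auto simp: indicator_def)
  qed
  have "(\<Sum>i<n. d i * indicator {\<tau> i<..\<tau> (Suc i)} s)\<^sup>2 = (\<Sum>i<n. (d i)\<^sup>2 * indicator {\<tau> i<..\<tau> (Suc i)} s)" for s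
  proof -
    have "(\<Sum>i<n. d i * indicator {\<tau> i<..\<tau> (Suc i)} s)\<^sup>2
        = (\<Sum>i<n. \<Sum>j<n. d i * d j * (indicator {\<tau> i<..\<tau> (Suc i)} s * indicator {\<tau> j<..\<tau> (Suc j)} s))"
      unfolding power2_eq_square sum_product by (simp only: mult_ac)
    also have "\<dots> = (\<Sum>i<n. \<Sum>j<n. if i = j then d i * d j * indicator {\<tau> i<..\<tau> (Suc i)} s else 0)"
      by (intro sum.cong refl) (simp add: disj)
    finally show ?thesis by (simp add: power2_eq_square)
  qed
  moreover have "has_bochner_integral lborel (\<lambda>s. \<Sum>i<n. (d i)\<^sup>2 * indicator {\<tau> i<..\<tau> (Suc i)} s)
    (\<Sum>i<n. (d i)\<^sup>2 * (\<tau> (Suc i) - \<tau> i))"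
  proof (intro has_bochner_integral_sum has_bochner_integral_mult_right)
    fix i assume "i \<in> {..<n}"
    then have "\<tau> i \<le> \<tau> (Suc i)" using mono by (simp add: less_imp_le)
    then show "has_bochner_integral lborel (indicator {\<tau> i<..\<tau> (Suc i)}) (\<tau> (Suc i) - \<tau> i)"
      using has_bochner_integral_real_indicator[of "{\<tau> i<..\<tau> (Suc i)}" lborel] by simp
  qed
  ultimately show ?thesis by simp
qed

lemma (in prob_space) char_centered_normal:
  assumes "distributed M lborel Y (normal_density 0 \<sigma>)" "\<sigma> > 0"
  shows "char (distr M borel Y) t = of_real (exp (- (t\<^sup>2 * \<sigma>\<^sup>2) / 2))"
proof -
  have Y [measurable]: "random_variable borel Y"
    using distributed_measurable[OF assms(1)] by simp
  have "distributed M lborel (\<lambda>\<omega>. (Y \<omega> - 0) / \<sigma>) std_normal_density"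
    using normal_standard_normal_convert[OF assms(2)] assms(1) by blast
  then have std: "distr M lborel (\<lambda>\<omega>. (Y \<omega> - 0) / \<sigma>) = std_normal_distribution"
    by (rule distributed_distr_eq_density)
  have "char (distr M borel Y) t = (CLINT \<omega>|M. iexp (t * Y \<omega>))"
    unfolding char_def by (subst integral_distr) auto
  also have "\<dots> = (CLINT \<omega>|M. iexp ((t * \<sigma>) * ((Y \<omega> - 0) / \<sigma>)))"
    using assms(2) by simp
  also have "\<dots> = char (distr M lborel (\<lambda>\<omega>. (Y \<omega> - 0) / \<sigma>)) (t * \<sigma>)"
    unfolding char_def by (subst integral_distr) auto
  finally show ?thesis
    unfolding std char_std_normal_distribution by (simp add: power_mult_distrib)
qed

text \<open>The Ito isometry for step functions in terms of characteristic functions: on the grid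
  the variances of independent increments add up in the same way as the squared norms of functions
  with disjoint supports.\<close>

lemma (in standard_wiener_process) char_step_integral:
  assumes xs: "\<And>a b c. (a, b, c) \<in> set xs \<Longrightarrow> 0 \<le> a \<and> a \<le> b"
  shows "(CLINT \<omega>|M. iexp (step_integral B xs \<omega>)) = of_real (exp (- (LINT s|lborel. (step_fun xs s)\<^sup>2) / 2))"
    and "integrable lborel (\<lambda>s. (step_fun xs s)\<^sup>2)"
    and "random_variable borel (step_integral B xs)"
proof -
  obtain \<tau> n where \<tau>: "0 \<le> \<tau> 0" "\<forall>i<n. \<tau> i < \<tau> (Suc i)"
    and grid: "\<forall>a b c. (a, b, c) \<in> set xs \<longrightarrow> (\<exists>p q. p \<le> q \<and> q \<le> n \<and> a = \<tau> p \<and> b = \<tau> q)"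
    using step_list_grid[of xs] xs by blast
  from step_fun_partition[OF \<tau>(2) grid, where B = B]
  obtain d where d: "step_fun xs = (\<lambda>s. \<Sum>i<n. d i * indicator {\<tau> i<..\<tau> (Suc i)} s)"
    "step_integral B xs = (\<lambda>\<omega>. \<Sum>i<n. d i * (B (\<tau> (Suc i)) \<omega> - B (\<tau> i) \<omega>))"
    by blast
  have bochner: "has_bochner_integral lborel (\<lambda>s. (step_fun xs s)\<^sup>2) (\<Sum>i<n. (d i)\<^sup>2 * (\<tau> (Suc i) - \<tau> i))"
    unfolding d by (rule integral_partition_step_square[OF \<tau>(2)])
  then show "integrable lborel (\<lambda>s. (step_fun xs s)\<^sup>2)" by (rule integrable.intros)
  have \<tau>_nonneg: "0 \<le> \<tau> i" if "i \<le> n" for i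
    using \<tau>(1) increasing_upto[OF \<tau>(2), of 0 i] that by simp
  have incr [measurable]: "random_variable borel (\<lambda>\<omega>. d i * (B (\<tau> (Suc i)) \<omega> - B (\<tau> i) \<omega>))" if "i < n" for i
    using that \<tau>_nonneg rv by (intro borel_measurable_times borel_measurable_diff) auto
  then show meas: "random_variable borel (step_integral B xs)"
    unfolding d by (intro borel_measurable_sum) auto
  have indep: "indep_vars (\<lambda>_. borel) (\<lambda>i \<omega>. d i * (B (\<tau> (Suc i)) \<omega> - B (\<tau> i) \<omega>)) {..<n}"
    using \<tau> by (intro indep_vars_compose2[OF increments_indep]) auto
  have char1: "char (distr M borel (\<lambda>\<omega>. d i * (B (\<tau> (Suc i)) \<omega> - B (\<tau> i) \<omega>))) 1
      = of_real (exp (- ((d i)\<^sup>2 * (\<tau> (Suc i) - \<tau> i)) / 2))" if i: "i < n" for i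
  proof -
    have [measurable]: "random_variable borel (\<lambda>\<omega>. B (\<tau> (Suc i)) \<omega> - B (\<tau> i) \<omega>)"
      using i \<tau>_nonneg rv by (intro borel_measurable_diff) auto
    have "char (distr M borel (\<lambda>\<omega>. d i * (B (\<tau> (Suc i)) \<omega> - B (\<tau> i) \<omega>))) 1
        = char (distr M borel (\<lambda>\<omega>. B (\<tau> (Suc i)) \<omega> - B (\<tau> i) \<omega>)) (d i)"
      unfolding char_def using incr[OF i] by (simp add: integral_distr)
    also have "\<dots> = of_real (exp (- ((d i)\<^sup>2 * (sqrt (\<tau> (Suc i) - \<tau> i))\<^sup>2) / 2))"
      using i \<tau>(2) \<tau>_nonneg[of i] by (intro char_centered_normal increment_normal) auto
    finally show ?thesis using \<tau>(2) i by (simp add: less_imp_le)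
  qed
  have "(CLINT \<omega>|M. iexp (step_integral B xs \<omega>)) = char (distr M borel (step_integral B xs)) 1"
    unfolding char_def using meas by (simp add: integral_distr)
  also have "\<dots> = (\<Prod>i<n. char (distr M borel (\<lambda>\<omega>. d i * (B (\<tau> (Suc i)) \<omega> - B (\<tau> i) \<omega>))) 1)"
    unfolding d by (rule char_distr_sum[OF indep])
  also have "\<dots> = (\<Prod>i<n. of_real (exp (- ((d i)\<^sup>2 * (\<tau> (Suc i) - \<tau> i)) / 2)))"
    by (intro prod.cong) (auto simp: char1)
  also have "\<dots> = of_real (exp (\<Sum>i<n. - ((d i)\<^sup>2 * (\<tau> (Suc i) - \<tau> i)) / 2))"
    by (simp only: exp_sum[OF finite_lessThan] of_real_prod)
  also have "(\<Sum>i<n. - ((d i)\<^sup>2 * (\<tau> (Suc i) - \<tau> i)) / 2) = - (LINT s|lborel. (step_fun xs s)\<^sup>2) / 2"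
    unfolding has_bochner_integral_integral_eq[OF bochner] by (simp add: sum_negf sum_divide_distrib)
  finally show "(CLINT \<omega>|M. iexp (step_integral B xs \<omega>)) = of_real (exp (- (LINT s|lborel. (step_fun xs s)\<^sup>2) / 2))" .
qed

section \<open>Mean-square limits of step integrals\<close>

lemma borel_measurable_step_fun [measurable]: "step_fun xs \<in> borel_measurable borel"
proof (induction xs)
  case Nil
  have "step_fun [] = (\<lambda>_. 0)" by (simp add: step_fun_def fun_eq_iff)
  then show ?case by simp
next
  case (Cons x xs)
  obtain a b c where x: "x = (a, b, c)" by (cases x)
  have "step_fun (x # xs) = (\<lambda>s. c * indicator {a<..b} s + step_fun xs s)"
    by (simp add: step_fun_def x fun_eq_iff)
  with Cons show ?case by simp
qed

text \<open>Mean-square convergence of step integrals as in \<^const>\<open>is_wiener_integral\<close>, but over the whole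
  half line, so that integrals up to different times can be added.\<close>

definition wiener_L2 :: "'a measure \<Rightarrow> (real \<Rightarrow> 'a \<Rightarrow> real) \<Rightarrow> (real \<Rightarrow> real) \<Rightarrow> ('a \<Rightarrow> real) \<Rightarrow> bool" where
  "wiener_L2 M B f Y \<longleftrightarrow> f \<in> borel_measurable borel \<and> Y \<in> borel_measurable M \<and>
    (\<exists>xs. (\<forall>n. \<forall>(a, b, c) \<in> set (xs n). 0 \<le> a \<and> a \<le> b) \<and>
      (\<lambda>n. \<integral>\<^sup>+s. ennreal ((f s - step_fun (xs n) s)\<^sup>2) \<partial>lborel) \<longlonglongrightarrow> 0 \<and>
      (\<lambda>n. \<integral>\<^sup>+\<omega>. ennreal ((Y \<omega> - step_integral B (xs n) \<omega>)\<^sup>2) \<partial>M) \<longlonglongrightarrow> 0)"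

lemma step_fun_eq_0:
  assumes "\<And>a b c. (a, b, c) \<in> set xs \<Longrightarrow> 0 \<le> a \<and> b \<le> t" "s \<notin> {0..t}"
  shows "step_fun xs s = 0"
  using assms(1)
proof (induction xs)
  case (Cons x xs)
  obtain a b c where x: "x = (a, b, c)" by (cases x)
  have "step_fun xs s = 0"
    by (rule Cons.IH, rule Cons.prems) auto
  moreover have "s \<notin> {a<..b}"
    using Cons.prems[of a b c] assms(2) x by auto
  ultimately show ?case by (simp add: step_fun_def x)
qed (simp add: step_fun_def)

text \<open>All intervals lie in [0, t], so the step functions vanish outside it and extending f by
  0 leaves the distances unchanged.\<close>

lemma is_wiener_integral_imp_wiener_L2:
  assumes "is_wiener_integral M B t f Y"
  shows "wiener_L2 M B (\<lambda>s. indicator {0..t} s * f s) Y"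
proof -
  from assms obtain xs where xs: "\<forall>n. \<forall>(a, b, c) \<in> set (xs n). 0 \<le> a \<and> a \<le> b \<and> b \<le> t"
    and lim: "(\<lambda>n. \<integral>\<^sup>+ s\<in>{0..t}. ennreal ((f s - step_fun (xs n) s)\<^sup>2) \<partial>lborel) \<longlonglongrightarrow> 0"
    and limY: "(\<lambda>n. \<integral>\<^sup>+\<omega>. ennreal ((Y \<omega> - step_integral B (xs n) \<omega>)\<^sup>2) \<partial>M) \<longlonglongrightarrow> 0"
    unfolding is_wiener_integral_def by blast
  have "step_fun (xs n) s = 0" if "s \<notin> {0..t}" for n s
    using xs that by (intro step_fun_eq_0[of _ t]) auto
  then have "ennreal ((f s - step_fun (xs n) s)\<^sup>2) * indicator {0..t} s
      = ennreal ((indicator {0..t} s * f s - step_fun (xs n) s)\<^sup>2)" for n s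
    by (cases "s \<in> {0..t}") auto
  with lim have "(\<lambda>n. \<integral>\<^sup>+s. ennreal ((indicator {0..t} s * f s - step_fun (xs n) s)\<^sup>2) \<partial>lborel) \<longlonglongrightarrow> 0"
    by simp
  moreover have "\<forall>n. \<forall>(a, b, c) \<in> set (xs n). 0 \<le> a \<and> a \<le> b"
  proof clarify
    fix n a b c assume "(a, b, c) \<in> set (xs n)"
    from xs[rule_format, OF this] show "0 \<le> a \<and> a \<le> b" by simp
  qed
  ultimately show ?thesis
    using assms limY unfolding wiener_L2_def is_wiener_integral_def set_borel_measurable_def by auto
qed

lemma step_fun_append: "step_fun (xs @ ys) s = step_fun xs s + step_fun ys s"
  by (simp add: step_fun_def)

lemma step_integral_append: "step_integral B (xs @ ys) \<omega> = step_integral B xs \<omega> + step_integral B ys \<omega>"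
  by (simp add: step_integral_def)

lemma step_fun_scale: "step_fun (map (\<lambda>(a, b, c). (a, b, k * c)) xs) s = k * step_fun xs s"
  by (induction xs) (auto simp: step_fun_def algebra_simps)

lemma step_integral_scale:
  "step_integral B (map (\<lambda>(a, b, c). (a, b, k * c)) xs) \<omega> = k * step_integral B xs \<omega>"
  by (induction xs) (auto simp: step_integral_def algebra_simps)

text \<open>From (a + b)^2 \<le> 2 a^2 + 2 b^2. Nonnegative integrals make the bound valid even
  where some of them are infinite.\<close>

lemma nn_integral_square_add_tendsto_0:
  fixes u v :: "nat \<Rightarrow> 'b \<Rightarrow> real"
  assumes [measurable]: "\<And>n. u n \<in> borel_measurable N" "\<And>n. v n \<in> borel_measurable N"
    and lim: "(\<lambda>n. \<integral>\<^sup>+x. ennreal ((u n x)\<^sup>2) \<partial>N) \<longlonglongrightarrow> 0" "(\<lambda>n. \<integral>\<^sup>+x. ennreal ((v n x)\<^sup>2) \<partial>N) \<longlonglongrightarrow> 0"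
  shows "(\<lambda>n. \<integral>\<^sup>+x. ennreal ((k * u n x + v n x)\<^sup>2) \<partial>N) \<longlonglongrightarrow> 0"
proof (rule tendsto_sandwich[of "\<lambda>_. 0"])
  have "(\<integral>\<^sup>+x. ennreal ((k * u n x + v n x)\<^sup>2) \<partial>N)
      \<le> ennreal (2 * k\<^sup>2) * (\<integral>\<^sup>+x. ennreal ((u n x)\<^sup>2) \<partial>N) + 2 * (\<integral>\<^sup>+x. ennreal ((v n x)\<^sup>2) \<partial>N)" for n
  proof -
    have "(k * u n x + v n x)\<^sup>2 \<le> 2 * k\<^sup>2 * (u n x)\<^sup>2 + 2 * (v n x)\<^sup>2" for x
      using zero_le_power2[of "k * u n x - v n x"] by (simp add: power2_sum power2_diff power_mult_distrib)
    then have "ennreal ((k * u n x + v n x)\<^sup>2) \<le> ennreal (2 * k\<^sup>2) * ennreal ((u n x)\<^sup>2) + 2 * ennreal ((v n x)\<^sup>2)" for x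
    proof -
      have "ennreal (2 * k\<^sup>2) * ennreal ((u n x)\<^sup>2) + 2 * ennreal ((v n x)\<^sup>2)
          = ennreal (2 * k\<^sup>2 * (u n x)\<^sup>2 + 2 * (v n x)\<^sup>2)"
        by (subst numeral_mult_ennreal, simp, subst ennreal_mult''[symmetric], simp, subst ennreal_plus) auto
      then show ?thesis
        using \<open>\<And>x. (k * u n x + v n x)\<^sup>2 \<le> 2 * k\<^sup>2 * (u n x)\<^sup>2 + 2 * (v n x)\<^sup>2\<close> by (simp only: ennreal_leI)
    qed
    then have "(\<integral>\<^sup>+x. ennreal ((k * u n x + v n x)\<^sup>2) \<partial>N)
        \<le> (\<integral>\<^sup>+x. ennreal (2 * k\<^sup>2) * ennreal ((u n x)\<^sup>2) + 2 * ennreal ((v n x)\<^sup>2) \<partial>N)"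
      by (intro nn_integral_mono)
    then show ?thesis by (simp add: nn_integral_add nn_integral_cmult)
  qed
  then show "\<forall>\<^sub>F n in sequentially. (\<integral>\<^sup>+x. ennreal ((k * u n x + v n x)\<^sup>2) \<partial>N)
      \<le> ennreal (2 * k\<^sup>2) * (\<integral>\<^sup>+x. ennreal ((u n x)\<^sup>2) \<partial>N) + 2 * (\<integral>\<^sup>+x. ennreal ((v n x)\<^sup>2) \<partial>N)"
    by (intro always_eventually allI)
  have "(\<lambda>n. ennreal (2 * k\<^sup>2) * (\<integral>\<^sup>+x. ennreal ((u n x)\<^sup>2) \<partial>N) + 2 * (\<integral>\<^sup>+x. ennreal ((v n x)\<^sup>2) \<partial>N))
      \<longlonglongrightarrow> ennreal (2 * k\<^sup>2) * 0 + 2 * 0"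
    by (intro tendsto_add ennreal_tendsto_cmult lim) auto
  then show "(\<lambda>n. ennreal (2 * k\<^sup>2) * (\<integral>\<^sup>+x. ennreal ((u n x)\<^sup>2) \<partial>N) + 2 * (\<integral>\<^sup>+x. ennreal ((v n x)\<^sup>2) \<partial>N)) \<longlonglongrightarrow> 0"
    by simp
qed auto

text \<open>Because overlapping intervals are allowed, approximating lists can be scaled and
  concatenated without refining them to a common grid.\<close>

lemma (in standard_wiener_process) wiener_L2_scale_add:
  assumes f: "wiener_L2 M B f Y" and g: "wiener_L2 M B g Z"
  shows "wiener_L2 M B (\<lambda>s. k * f s + g s) (\<lambda>\<omega>. k * Y \<omega> + Z \<omega>)"
proof -
  have [measurable]: "f \<in> borel_measurable borel" "g \<in> borel_measurable borel"
    "random_variable borel Y" "random_variable borel Z"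
    using f g by (auto simp: wiener_L2_def)
  from f obtain xs where xs: "\<forall>n. \<forall>(a, b, c) \<in> set (xs n). 0 \<le> a \<and> a \<le> b"
    "(\<lambda>n. \<integral>\<^sup>+s. ennreal ((f s - step_fun (xs n) s)\<^sup>2) \<partial>lborel) \<longlonglongrightarrow> 0"
    "(\<lambda>n. \<integral>\<^sup>+\<omega>. ennreal ((Y \<omega> - step_integral B (xs n) \<omega>)\<^sup>2) \<partial>M) \<longlonglongrightarrow> 0"
    unfolding wiener_L2_def by blast
  from g obtain ys where ys: "\<forall>n. \<forall>(a, b, c) \<in> set (ys n). 0 \<le> a \<and> a \<le> b"
    "(\<lambda>n. \<integral>\<^sup>+s. ennreal ((g s - step_fun (ys n) s)\<^sup>2) \<partial>lborel) \<longlonglongrightarrow> 0"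
    "(\<lambda>n. \<integral>\<^sup>+\<omega>. ennreal ((Z \<omega> - step_integral B (ys n) \<omega>)\<^sup>2) \<partial>M) \<longlonglongrightarrow> 0"
    unfolding wiener_L2_def by blast
  have [measurable]: "random_variable borel (step_integral B (xs n))" "random_variable borel (step_integral B (ys n))" for n
    using xs(1) ys(1) by (auto intro!: char_step_integral(3))
  define zs where "zs n = map (\<lambda>(a, b, c). (a, b, k * c)) (xs n) @ ys n" for n
  have "\<forall>n. \<forall>(a, b, c) \<in> set (zs n). 0 \<le> a \<and> a \<le> b"
  proof clarify
    fix n a b c assume "(a, b, c) \<in> set (zs n)"
    then consider c' where "(a, b, c') \<in> set (xs n)" | "(a, b, c) \<in> set (ys n)"
      by (auto simp: zs_def)
    then show "0 \<le> a \<and> a \<le> b"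
      by cases (use xs(1)[rule_format, of "(a, b, _)" n] ys(1)[rule_format, of "(a, b, c)" n] in auto)
  qed
  moreover have "(\<lambda>n. \<integral>\<^sup>+s. ennreal (((k * f s + g s) - step_fun (zs n) s)\<^sup>2) \<partial>lborel) \<longlonglongrightarrow> 0"
  proof -
    have eq: "(k * f s + g s) - step_fun (zs n) s = k * (f s - step_fun (xs n) s) + (g s - step_fun (ys n) s)" for n s
      by (simp add: zs_def step_fun_append step_fun_scale right_diff_distrib)
    show ?thesis
      unfolding eq by (intro nn_integral_square_add_tendsto_0 xs ys) auto
  qed
  moreover have "(\<lambda>n. \<integral>\<^sup>+\<omega>. ennreal (((k * Y \<omega> + Z \<omega>) - step_integral B (zs n) \<omega>)\<^sup>2) \<partial>M) \<longlonglongrightarrow> 0"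
  proof -
    have eq: "(k * Y \<omega> + Z \<omega>) - step_integral B (zs n) \<omega>
        = k * (Y \<omega> - step_integral B (xs n) \<omega>) + (Z \<omega> - step_integral B (ys n) \<omega>)" for n \<omega>
      by (simp add: zs_def step_integral_append step_integral_scale right_diff_distrib)
    show ?thesis
      unfolding eq by (intro nn_integral_square_add_tendsto_0 xs ys) auto
  qed
  ultimately show ?thesis unfolding wiener_L2_def by auto
qed

lemma (in standard_wiener_process) wiener_L2_sum:
  fixes n :: nat
  assumes "\<And>i. i < n \<Longrightarrow> wiener_L2 M B (f i) (Y i)"
  shows "wiener_L2 M B (\<lambda>s. \<Sum>i<n. k i * f i s) (\<lambda>\<omega>. \<Sum>i<n. k i * Y i \<omega>)"
  using assms
proof (induction n)
  case 0
  have "step_fun [] s = 0" "step_integral B [] \<omega> = 0" for s \<omega>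
    by (simp_all add: step_fun_def step_integral_def)
  then show ?case
    unfolding wiener_L2_def by (intro conjI exI[of _ "\<lambda>_. []"]) auto
next
  case (Suc n)
  then show ?case
    using wiener_L2_scale_add[OF Suc.prems[of n] Suc.IH, of "k n"] by (simp add: add.commute)
qed

text \<open>Passage from nonnegative to Bochner integrals. Integrability can only hold eventually,
  since early terms of the sequence may be infinite.\<close>

lemma nn_integral_square_tendsto_0_real:
  fixes u :: "nat \<Rightarrow> 'b \<Rightarrow> real"
  assumes [measurable]: "\<And>n. u n \<in> borel_measurable N"
    and lim: "(\<lambda>n. \<integral>\<^sup>+x. ennreal ((u n x)\<^sup>2) \<partial>N) \<longlonglongrightarrow> 0"
  shows "\<forall>\<^sub>F n in sequentially. integrable N (\<lambda>x. (u n x)\<^sup>2)"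
    and "(\<lambda>n. LINT x|N. (u n x)\<^sup>2) \<longlonglongrightarrow> 0"
proof -
  have "\<forall>\<^sub>F n in sequentially. (\<integral>\<^sup>+x. ennreal ((u n x)\<^sup>2) \<partial>N) < 1"
    using order_tendstoD(2)[OF lim, of 1] by simp
  then show "\<forall>\<^sub>F n in sequentially. integrable N (\<lambda>x. (u n x)\<^sup>2)"
  proof eventually_elim
    case (elim n)
    then have "(\<integral>\<^sup>+x. ennreal ((u n x)\<^sup>2) \<partial>N) < \<infinity>"
      using ennreal_one_less_top by (auto intro: less_trans)
    then show ?case by (intro integrableI_nonneg) auto
  qed
  have "(\<lambda>n. enn2real (\<integral>\<^sup>+x. ennreal ((u n x)\<^sup>2) \<partial>N)) \<longlonglongrightarrow> 0"
    using lim by (intro tendsto_enn2real) auto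
  then show "(\<lambda>n. LINT x|N. (u n x)\<^sup>2) \<longlonglongrightarrow> 0"
    by (simp add: integral_eq_nn_integral)
qed

text \<open>Weighted AM-GM replaces the Cauchy--Schwarz inequality in the next two limits.\<close>

lemma tendsto_if_weighted_bound:
  fixes a :: "nat \<Rightarrow> 'b::real_normed_vector" and D :: "nat \<Rightarrow> real"
  assumes D: "D \<longlonglongrightarrow> 0" and "K \<ge> 0"
    and bound: "\<And>\<eta>. \<eta> > 0 \<Longrightarrow> \<forall>\<^sub>F n in sequentially. norm (a n - l) \<le> \<eta> * K + (1 + 1 / \<eta>) * D n"
  shows "a \<longlonglongrightarrow> l"
proof (rule tendstoI)
  fix e :: real assume "e > 0"
  \<comment> \<open>Half of e is spent on \<eta> K and half on the multiple of D; the summand 1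
    covers K = 0.\<close>
  define \<eta> where "\<eta> = e / (2 * (K + 1))"
  have "\<eta> > 0" "\<eta> * K < e / 2"
    using \<open>e > 0\<close> \<open>K \<ge> 0\<close> by (auto simp: \<eta>_def field_simps)
  have "(\<lambda>n. (1 + 1 / \<eta>) * D n) \<longlonglongrightarrow> (1 + 1 / \<eta>) * 0"
    by (intro tendsto_intros D)
  then have "\<forall>\<^sub>F n in sequentially. (1 + 1 / \<eta>) * D n < e / 2"
    using \<open>e > 0\<close> by (intro order_tendstoD(2)) auto
  with bound[OF \<open>\<eta> > 0\<close>] show "\<forall>\<^sub>F n in sequentially. dist (a n) l < e"
  proof eventually_elim
    case (elim n)
    then show ?case using \<open>\<eta> * K < e / 2\<close> unfolding dist_norm by linarith
  qed
qed

lemma L2_norm_tendsto: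
  fixes f :: "'b \<Rightarrow> real" and g :: "nat \<Rightarrow> 'b \<Rightarrow> real"
  assumes [measurable]: "f \<in> borel_measurable N" "\<And>n. g n \<in> borel_measurable N"
    and f: "integrable N (\<lambda>x. (f x)\<^sup>2)" and g: "\<And>n. integrable N (\<lambda>x. (g n x)\<^sup>2)"
    and lim: "(\<lambda>n. \<integral>\<^sup>+x. ennreal ((f x - g n x)\<^sup>2) \<partial>N) \<longlonglongrightarrow> 0"
  shows "(\<lambda>n. LINT x|N. (g n x)\<^sup>2) \<longlonglongrightarrow> (LINT x|N. (f x)\<^sup>2)"
proof (rule tendsto_if_weighted_bound)
  note D = nn_integral_square_tendsto_0_real[OF _ lim]
  show "(\<lambda>n. LINT x|N. (f x - g n x)\<^sup>2) \<longlonglongrightarrow> 0" by (rule D) simp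
  show "0 \<le> (LINT x|N. (f x)\<^sup>2)" by simp
  fix \<eta> :: real assume "\<eta> > 0"
  have "\<forall>\<^sub>F n in sequentially. integrable N (\<lambda>x. (f x - g n x)\<^sup>2)" by (rule D) simp
  then show "\<forall>\<^sub>F n in sequentially. norm ((LINT x|N. (g n x)\<^sup>2) - (LINT x|N. (f x)\<^sup>2))
      \<le> \<eta> * (LINT x|N. (f x)\<^sup>2) + (1 + 1 / \<eta>) * (LINT x|N. (f x - g n x)\<^sup>2)"
  proof eventually_elim
    case (elim n)
    have "\<bar>(g n x)\<^sup>2 - (f x)\<^sup>2\<bar> \<le> \<eta> * (f x)\<^sup>2 + (1 + 1 / \<eta>) * (f x - g n x)\<^sup>2" for x
    proof -
      define d where "d = f x - g n x"
      have eq: "(g n x)\<^sup>2 - (f x)\<^sup>2 = d\<^sup>2 - 2 * (f x * d)"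
        by (simp add: d_def power2_eq_square algebra_simps)
      \<comment> \<open>Expanding both squares bounds the cross term with either sign.\<close>
      have "0 \<le> (sqrt \<eta> * f x + d / sqrt \<eta>)\<^sup>2" "0 \<le> (sqrt \<eta> * f x - d / sqrt \<eta>)\<^sup>2"
        by simp_all
      then have "\<bar>2 * (f x * d)\<bar> \<le> \<eta> * (f x)\<^sup>2 + 1 / \<eta> * d\<^sup>2"
        using \<open>\<eta> > 0\<close> by (simp add: power2_sum power2_diff power_mult_distrib power_divide abs_le_iff)
      moreover have "0 \<le> d\<^sup>2" by simp
      ultimately show ?thesis
        unfolding eq d_def[symmetric] distrib_right by linarith
    qed
    then have "norm (LINT x|N. (g n x)\<^sup>2 - (f x)\<^sup>2) \<le> (LINT x|N. \<eta> * (f x)\<^sup>2 + (1 + 1 / \<eta>) * (f x - g n x)\<^sup>2)"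
      using elim f g by (intro order_trans[OF integral_norm_bound integral_mono]) auto
    then show ?case using elim f g by simp
  qed
qed

lemma norm_iexp_diff_le: "norm (iexp x - iexp y) \<le> \<bar>x - y\<bar>"
proof -
  have "iexp x - iexp y = iexp y * (iexp (x - y) - 1)"
    by (simp add: right_diff_distrib exp_diff)
  then have "norm (iexp x - iexp y) = norm (iexp y) * norm (iexp (x - y) - 1)"
    by (simp only: norm_mult)
  also have "\<dots> \<le> \<bar>x - y\<bar>"
    using iexp_approx1[of "x - y" 0] by simp
  finally show ?thesis .
qed

lemma (in prob_space) char_tendsto_if_L2:
  fixes Y :: "'a \<Rightarrow> real" and Z :: "nat \<Rightarrow> 'a \<Rightarrow> real"
  assumes [measurable]: "random_variable borel Y" "\<And>n. random_variable borel (Z n)"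
    and lim: "(\<lambda>n. \<integral>\<^sup>+\<omega>. ennreal ((Y \<omega> - Z n \<omega>)\<^sup>2) \<partial>M) \<longlonglongrightarrow> 0"
  shows "(\<lambda>n. CLINT \<omega>|M. iexp (Z n \<omega>)) \<longlonglongrightarrow> (CLINT \<omega>|M. iexp (Y \<omega>))"
proof (rule tendsto_if_weighted_bound)
  note D = nn_integral_square_tendsto_0_real[OF _ lim]
  show "(\<lambda>n. expectation (\<lambda>\<omega>. (Y \<omega> - Z n \<omega>)\<^sup>2)) \<longlonglongrightarrow> 0" by (rule D) simp
  show "(0::real) \<le> 1" by simp
  fix \<eta> :: real assume "\<eta> > 0"
  have int: "integrable M (\<lambda>\<omega>. iexp (V \<omega>))" if [measurable]: "random_variable borel V" for V
    by (rule integrable_const_bound[where B = 1]) auto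
  have "\<forall>\<^sub>F n in sequentially. integrable M (\<lambda>\<omega>. (Y \<omega> - Z n \<omega>)\<^sup>2)" by (rule D) simp
  then show "\<forall>\<^sub>F n in sequentially. norm ((CLINT \<omega>|M. iexp (Z n \<omega>)) - (CLINT \<omega>|M. iexp (Y \<omega>)))
      \<le> \<eta> * 1 + (1 + 1 / \<eta>) * expectation (\<lambda>\<omega>. (Y \<omega> - Z n \<omega>)\<^sup>2)"
  proof eventually_elim
    case (elim n)
    have "norm (iexp (Z n \<omega>) - iexp (Y \<omega>)) \<le> \<eta> * 1 + (1 + 1 / \<eta>) * (Y \<omega> - Z n \<omega>)\<^sup>2" for \<omega>
    proof -
      define d where "d = \<bar>Y \<omega> - Z n \<omega>\<bar>"
      have "norm (iexp (Z n \<omega>) - iexp (Y \<omega>)) \<le> d"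
        using norm_iexp_diff_le[of "Z n \<omega>" "Y \<omega>"] by (simp add: d_def abs_minus_commute)
      \<comment> \<open>Either d \<le> \<eta>, or d / \<eta> exceeds 1 and multiplying by it gives d
        \<le> d^2 / \<eta>. A first moment is thus controlled by the second.\<close>
      moreover have "d \<le> \<eta> + 1 / \<eta> * d\<^sup>2"
      proof (cases "d \<le> \<eta>")
        case True
        moreover have "0 \<le> 1 / \<eta> * d\<^sup>2" using \<open>\<eta> > 0\<close> by simp
        ultimately show ?thesis by linarith
      next
        case False
        then have "\<eta> * d \<le> d * d" using \<open>\<eta> > 0\<close> by (intro mult_right_mono) auto
        then have "d \<le> 1 / \<eta> * d\<^sup>2" using \<open>\<eta> > 0\<close> by (simp add: field_simps power2_eq_square)
        with \<open>\<eta> > 0\<close> show ?thesis by linarith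
      qed
      moreover have "d\<^sup>2 = (Y \<omega> - Z n \<omega>)\<^sup>2" "0 \<le> (Y \<omega> - Z n \<omega>)\<^sup>2" by (simp_all add: d_def)
      ultimately show ?thesis by (simp only: distrib_right mult_1_left mult_1_right)
    qed
    then have "norm (CLINT \<omega>|M. iexp (Z n \<omega>) - iexp (Y \<omega>)) \<le> expectation (\<lambda>\<omega>. \<eta> * 1 + (1 + 1 / \<eta>) * (Y \<omega> - Z n \<omega>)\<^sup>2)"
      using elim by (intro order_trans[OF integral_norm_bound integral_mono] integrable_norm
          Bochner_Integration.integrable_diff int) auto
    then show ?case
      using elim by (simp add: int Bochner_Integration.integral_diff prob_space)
  qed
qed

text \<open>Both the characteristic function and the squared norm are continuous under mean-square
  approximation, so the formula passes from step functions to f. Square integrability of f rules out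
  a default value of the integral in the exponent.\<close>

theorem (in standard_wiener_process) wiener_L2_char:
  assumes Y: "wiener_L2 M B f Y" and f: "integrable lborel (\<lambda>s. (f s)\<^sup>2)"
  shows "(CLINT \<omega>|M. iexp (Y \<omega>)) = of_real (exp (- (LINT s|lborel. (f s)\<^sup>2) / 2))"
proof -
  from Y have [measurable]: "f \<in> borel_measurable borel" "random_variable borel Y"
    by (auto simp: wiener_L2_def)
  from Y obtain xs where xs: "\<forall>n. \<forall>(a, b, c) \<in> set (xs n). 0 \<le> a \<and> a \<le> b"
    and lim: "(\<lambda>n. \<integral>\<^sup>+s. ennreal ((f s - step_fun (xs n) s)\<^sup>2) \<partial>lborel) \<longlonglongrightarrow> 0"
      "(\<lambda>n. \<integral>\<^sup>+\<omega>. ennreal ((Y \<omega> - step_integral B (xs n) \<omega>)\<^sup>2) \<partial>M) \<longlonglongrightarrow> 0"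
    unfolding wiener_L2_def by blast
  have step: "(CLINT \<omega>|M. iexp (step_integral B (xs n) \<omega>)) = of_real (exp (- (LINT s|lborel. (step_fun (xs n) s)\<^sup>2) / 2))"
    "integrable lborel (\<lambda>s. (step_fun (xs n) s)\<^sup>2)" "random_variable borel (step_integral B (xs n))" for n
    using xs by (intro char_step_integral; auto)+
  have "(\<lambda>n. CLINT \<omega>|M. iexp (step_integral B (xs n) \<omega>)) \<longlonglongrightarrow> (CLINT \<omega>|M. iexp (Y \<omega>))"
    using step(3) lim(2) by (intro char_tendsto_if_L2) auto
  moreover have "(\<lambda>n. LINT s|lborel. (step_fun (xs n) s)\<^sup>2) \<longlonglongrightarrow> (LINT s|lborel. (f s)\<^sup>2)"
    using f step(2) lim(1) by (intro L2_norm_tendsto) auto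
  then have "(\<lambda>n. complex_of_real (exp (- (LINT s|lborel. (step_fun (xs n) s)\<^sup>2) / 2)))
      \<longlonglongrightarrow> of_real (exp (- (LINT s|lborel. (f s)\<^sup>2) / 2))"
    by (intro tendsto_intros) auto
  ultimately show ?thesis
    unfolding step(1) by (rule LIMSEQ_unique)
qed

subsection \<open>Time change of the bridge\<close>

lemma (in prob_space) indep_vars_reindex_inj:
  assumes inj: "inj_on f I" and indep: "indep_vars N X (f ` I)"
  shows "indep_vars (\<lambda>i. N (f i)) (\<lambda>i. X (f i)) I"
  unfolding indep_vars_def2 indep_sets_def
proof (intro conjI ballI allI impI)
  fix J A assume J: "J \<subseteq> I" "J \<noteq> {}" "finite J"
    and A: "A \<in> (\<Pi> i\<in>J. {X (f i) -` A \<inter> space M | A. A \<in> sets (N (f i))})"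
  have injJ: "inj_on f J" using inj J(1) by (rule inj_on_subset)
  define A' where "A' = A \<circ> the_inv_into J f"
  have A': "A' (f j) = A j" if "j \<in> J" for j
    using the_inv_into_f_f[OF injJ that] by (simp add: A'_def)
  have "prob (\<Inter>i\<in>f ` J. A' i) = (\<Prod>i\<in>f ` J. prob (A' i))"
  proof (rule indep_setsD)
    show "indep_sets (\<lambda>i. {X i -` A \<inter> space M | A. A \<in> sets (N i)}) (f ` I)"
      using indep by (simp add: indep_vars_def2)
    show "\<forall>i\<in>f ` J. A' i \<in> {X i -` A \<inter> space M | A. A \<in> sets (N i)}"
      using A A' by (auto simp: Pi_iff)
  qed (use J in auto)
  then show "prob (\<Inter>j\<in>J. A j) = (\<Prod>j\<in>J. prob (A j))"
    using A' injJ by (simp add: prod.reindex)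
qed (use indep in \<open>auto simp: indep_vars_def2\<close>)

lemma has_bochner_integral_inverse_distance:
  fixes a T :: real
  assumes "0 \<le> a" "a < T"
  shows "has_bochner_integral lborel (\<lambda>s. 1 / (T - s) * indicator {0..a} s) (ln (T / (T - a)))"
proof -
  have "has_bochner_integral lborel (\<lambda>s. 1 / (T - s) * indicator {0..a} s) (- ln (T - a) - (- ln (T - 0)))"
    using assms
    by (intro has_bochner_integral_FTC_Icc_real[where F = "\<lambda>s. - ln (T - s)"]) (auto intro!: derivative_eq_intros continuous_intros)
  then show ?thesis using assms by (simp add: ln_div)
qed

lemma continuous_on_bridge_path:
  assumes "continuous_on {0..<T} x" "S < T"
  shows "continuous_on {0..S} (\<lambda>u. (x u)\<^sup>2 / (T - u)\<^sup>2 :: real)"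
  using assms by (intro continuous_intros continuous_on_subset[OF assms(1)]) auto

locale bridge_time_change = alpha_wiener_bridge M B "1/2" T X
  for M :: "'a measure" and B :: "real \<Rightarrow> 'a \<Rightarrow> real" and T :: real and X :: "real \<Rightarrow> 'a \<Rightarrow> real" +
  fixes S :: real
  assumes S: "0 < S" "S < T"
begin

text \<open>The integral of 1 / (T - s) over [0, S], which is the variance of X S / sqrt (T -
  S).\<close>

definition L :: real where "L = ln (T / (T - S))"

text \<open>The inverse of u \<mapsto> ln (T / (T - u)) / L; it carries [0, 1] onto [0, S].\<close>

definition clock :: "real \<Rightarrow> real" where "clock v = T * (1 - exp (- L * v))"

text \<open>The bridge, rescaled to unit variance rate and run along \<open>clock\<close>, is a Wiener process.\<close>

definition W :: "real \<Rightarrow> 'a \<Rightarrow> real" where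
  "W v \<omega> = X (clock v) \<omega> / (sqrt L * sqrt (T - clock v))"

lemma L_pos: "0 < L"
  unfolding L_def using S by (simp add: ln_gt_zero)

lemma T_minus_clock: "T - clock v = T * exp (- L * v)"
  by (simp add: clock_def algebra_simps)

lemma clock_less: "clock v < T"
  using T_minus_clock[of v] T_pos by (metis diff_gt_0_iff_gt exp_gt_zero mult_pos_pos)

lemma clock_0: "clock 0 = 0"
  by (simp add: clock_def)

lemma clock_1: "clock 1 = S"
proof -
  have "exp (- L) = (T - S) / T"
    using S T_pos by (simp add: L_def exp_minus)
  then show ?thesis using T_pos by (simp add: clock_def field_simps)
qed

lemma clock_mono: "v \<le> v' \<Longrightarrow> clock v \<le> clock v'"
  using T_pos L_pos by (simp add: clock_def)

lemma clock_min: "clock (min v v') = min (clock v) (clock v')"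
  using clock_mono by (intro min_of_mono[symmetric] monoI)

lemma clock_nonneg: "0 \<le> v \<Longrightarrow> 0 \<le> clock v"
  using clock_mono[of 0 v] by (simp add: clock_0)

lemma log_clock: "ln (T / (T - clock v)) = L * v"
  using T_pos by (simp add: T_minus_clock ln_div ln_mult)

lemma clock_deriv: "(clock has_field_derivative L * (T - clock v)) (at v within A)"
proof -
  have "(clock has_field_derivative L * (T * exp (- L * v))) (at v within A)"
    unfolding clock_def[abs_def] by (auto intro!: derivative_eq_intros)
  then show ?thesis by (simp only: T_minus_clock)
qed

lemma continuous_on_clock: "continuous_on A clock"
  unfolding clock_def[abs_def] by (intro continuous_intros)

lemma wiener_L2_X:
  assumes "0 \<le> t" "t < T"
  shows "wiener_L2 M B (\<lambda>s. indicator {0..t} s * ((T - t) / (T - s)) powr (1/2)) (X t)"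
  by (rule is_wiener_integral_imp_wiener_L2[OF bridge_integral[OF assms]])

text \<open>In the kernel sqrt ((T - t) / (T - s)) the dependence on t is a factor that the
  normalization of W cancels. What remains is 1 / sqrt (L (T - s)) on [0, t], so a product of two
  such kernels is 1 / (L (T - s)) up to the earlier of the two times, and \<open>clock\<close>
  commutes with min.\<close>

lemma W_gauss:
  fixes n :: nat
  assumes v: "\<And>i. i < n \<Longrightarrow> v i \<in> {0..1}"
  shows "(CLINT \<omega>|M. iexp (\<Sum>i<n. b i * W (v i) \<omega>))
    = of_real (exp (- (\<Sum>i<n. \<Sum>j<n. b i * b j * min (v i) (v j)) / 2))"
proof -
  define k where "k i = b i / (sqrt L * sqrt (T - clock (v i)))" for i
  define f where "f s = (\<Sum>i<n. k i * (indicator {0..clock (v i)} s * ((T - clock (v i)) / (T - s)) powr (1/2)))" for s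
  have "wiener_L2 M B f (\<lambda>\<omega>. \<Sum>i<n. k i * X (clock (v i)) \<omega>)"
    unfolding f_def using v by (intro wiener_L2_sum wiener_L2_X clock_nonneg clock_less) auto
  moreover have "k i * X (clock (v i)) \<omega> = b i * W (v i) \<omega>" for i \<omega>
    by (simp add: k_def W_def)
  ultimately have wiener: "wiener_L2 M B f (\<lambda>\<omega>. \<Sum>i<n. b i * W (v i) \<omega>)"
    by simp
  have single: "k i * (indicator {0..clock (v i)} s * ((T - clock (v i)) / (T - s)) powr (1/2))
      = b i * indicator {0..clock (v i)} s / sqrt (L * (T - s))" for i s
  proof (cases "s \<in> {0..clock (v i)}")
    case True
    then have "s < T" using clock_less[of "v i"] by auto
    then show ?thesis
      using clock_less[of "v i"] L_pos
      by (simp add: k_def powr_half_sqrt real_sqrt_divide real_sqrt_mult)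
  qed simp
  have pair: "b i * indicator {0..clock (v i)} s / sqrt (L * (T - s)) * (b j * indicator {0..clock (v j)} s / sqrt (L * (T - s)))
      = b i * b j / L * (1 / (T - s) * indicator {0..clock (min (v i) (v j))} s)" for i j s
  proof (cases "s \<in> {0..clock (v i)} \<inter> {0..clock (v j)}")
    case True
    then have "s < T" using clock_less[of "v i"] by auto
    then have "sqrt (L * (T - s)) * sqrt (L * (T - s)) = L * (T - s)"
      using L_pos by simp
    moreover have "s \<in> {0..clock (min (v i) (v j))}"
      using True by (simp add: clock_min)
    ultimately show ?thesis using True by (simp add: mult.commute)
  next
    case False
    then have "s \<notin> {0..clock (min (v i) (v j))}"
      by (auto simp: clock_min)
    then show ?thesis using False by auto
  qed
  have "(f s)\<^sup>2 = (\<Sum>i<n. \<Sum>j<n. b i * b j / L * (1 / (T - s) * indicator {0..clock (min (v i) (v j))} s))" for s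
    unfolding f_def single power2_eq_square sum_product pair ..
  \<comment> \<open>The logarithm obtained by integrating 1 / (T - s) up to the clock time is L
    times the original time, which is the purpose of the clock.\<close>
  moreover have "has_bochner_integral lborel
      (\<lambda>s. \<Sum>i<n. \<Sum>j<n. b i * b j / L * (1 / (T - s) * indicator {0..clock (min (v i) (v j))} s))
      (\<Sum>i<n. \<Sum>j<n. b i * b j / L * (L * min (v i) (v j)))"
    unfolding log_clock[symmetric] using v
    by (intro has_bochner_integral_sum has_bochner_integral_mult_right has_bochner_integral_inverse_distance
        clock_nonneg clock_less) auto
  moreover have "b i * b j / L * (L * min (v i) (v j)) = b i * b j * min (v i) (v j)" for i j
    using L_pos by simp
  ultimately have f2: "has_bochner_integral lborel (\<lambda>s. (f s)\<^sup>2) (\<Sum>i<n. \<Sum>j<n. b i * b j * min (v i) (v j))"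
    by simp
  show ?thesis
    using wiener_L2_char[OF wiener integrable.intros[OF f2]]
    unfolding has_bochner_integral_integral_eq[OF f2] .
qed

lemma W_measurable: "v \<in> {0..1} \<Longrightarrow> random_variable borel (W v)"
  using wiener_L2_X[of "clock v"] clock_nonneg[of v] clock_less[of v]
  unfolding wiener_L2_def W_def by (intro borel_measurable_divide) auto

lemma W_continuous:
  assumes "continuous_on {0..<T} (\<lambda>t. X t \<omega>)"
  shows "continuous_on {0..1} (\<lambda>v. W v \<omega>)"
proof -
  have "clock v \<noteq> T" "T \<noteq> clock v" for v
    using clock_less[of v] by auto
  then show ?thesis
    unfolding W_def using clock_less clock_nonneg L_pos
    by (intro continuous_intros continuous_on_compose2[OF assms] continuous_on_clock) auto
qed

text \<open>At t = 0 every interval in the approximating lists is degenerate, so all step integrals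
  vanish and X 0 is a mean-square limit of zeros.\<close>

lemma W_start: "AE \<omega> in M. W 0 \<omega> = 0"
proof -
  from bridge_integral[of 0] T_pos obtain xs
    where [measurable]: "random_variable borel (X 0)"
      and xs: "\<forall>n. \<forall>(a, b, c) \<in> set (xs n). 0 \<le> a \<and> a \<le> b \<and> b \<le> (0::real)"
      and lim: "(\<lambda>n. \<integral>\<^sup>+\<omega>. ennreal ((X 0 \<omega> - step_integral B (xs n) \<omega>)\<^sup>2) \<partial>M) \<longlonglongrightarrow> 0"
    unfolding is_wiener_integral_def by blast
  have zero: "step_integral B ys \<omega> = 0" if "\<forall>(a, b, c) \<in> set ys. 0 \<le> a \<and> a \<le> b \<and> b \<le> (0::real)" for ys \<omega>
    using that
  proof (induction ys)
    case (Cons y ys)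
    obtain a b c where y: "y = (a, b, c)" by (cases y)
    with Cons.prems have "a = b" by simp
    then show ?case using Cons y by (simp add: step_integral_def)
  qed (simp add: step_integral_def)
  have "step_integral B (xs n) \<omega> = 0" for n \<omega>
    by (rule zero, rule xs[THEN spec])
  with lim have "(\<integral>\<^sup>+\<omega>. ennreal ((X 0 \<omega>)\<^sup>2) \<partial>M) = 0"
    by (simp add: LIMSEQ_const_iff)
  then have "AE \<omega> in M. X 0 \<omega> = 0"
    by (subst (asm) nn_integral_0_iff_AE) auto
  then show ?thesis
    by eventually_elim (simp add: W_def clock_0)
qed

text \<open>The derivative of the clock supplies L (T - u), which cancels one factor T - u of the
  denominator; the other is absorbed in W together with a further L. This leaves the constant weight
  L^2.\<close>

lemma square_integral_time_change:
  assumes "continuous_on {0..<T} (\<lambda>t. X t \<omega>)"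
  shows "set_integrable lborel {0..S} (\<lambda>u. (X u \<omega>)\<^sup>2 / (T - u)\<^sup>2)"
    and "(LINT u:{0..S}|lborel. (X u \<omega>)\<^sup>2 / (T - u)\<^sup>2) = L\<^sup>2 * integral {0..1} (\<lambda>v. (W v \<omega>)\<^sup>2)"
proof -
  note cont = continuous_on_bridge_path[OF assms S(2)]
  show int: "set_integrable lborel {0..S} (\<lambda>u. (X u \<omega>)\<^sup>2 / (T - u)\<^sup>2)"
    by (rule borel_integrable_atLeastAtMost'[OF cont])
  have "((\<lambda>v. (L * (T - clock v)) *\<^sub>R ((X (clock v) \<omega>)\<^sup>2 / (T - clock v)\<^sup>2)) has_integral
      integral {clock 0..clock 1} (\<lambda>u. (X u \<omega>)\<^sup>2 / (T - u)\<^sup>2)) {0..1}"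
  proof (rule has_integral_substitution[where c = 0 and d = S])
    show "clock ` {0..1} \<subseteq> {0..S}"
      using clock_mono[of _ 1] clock_nonneg by (auto simp: clock_1)
    show "clock 0 \<le> clock 1" by (rule clock_mono) simp
    show "(clock has_real_derivative L * (T - clock v)) (at v within {0..1})" for v
      by (rule clock_deriv)
  qed (simp_all add: cont)
  moreover have "(L * (T - clock v)) *\<^sub>R ((X (clock v) \<omega>)\<^sup>2 / (T - clock v)\<^sup>2) = L\<^sup>2 * (W v \<omega>)\<^sup>2" for v
  proof -
    have "(W v \<omega>)\<^sup>2 = (X (clock v) \<omega>)\<^sup>2 / (L * (T - clock v))"
      using clock_less[of v] L_pos by (simp add: W_def power_divide power_mult_distrib less_imp_le)
    then show ?thesis
      using clock_less[of v] L_pos by (simp add: power2_eq_square)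
  qed
  ultimately have "integral {0..1} (\<lambda>v. L\<^sup>2 * (W v \<omega>)\<^sup>2) = integral {0..S} (\<lambda>u. (X u \<omega>)\<^sup>2 / (T - u)\<^sup>2)"
    by (simp only: clock_0 clock_1 integral_unique)
  then show "(LINT u:{0..S}|lborel. (X u \<omega>)\<^sup>2 / (T - u)\<^sup>2) = L\<^sup>2 * integral {0..1} (\<lambda>v. (W v \<omega>)\<^sup>2)"
    using set_borel_integral_eq_integral(2)[OF int] by simp
qed

end

theorem mainTheorem3:
  fixes M :: "'a measure" and B X :: "real \<Rightarrow> 'a \<Rightarrow> real" and S T :: real
  assumes "0 < S" and "S < T"
    and "alpha_wiener_bridge M B (1/2) T X"
  shows "\<exists>\<xi> :: nat \<Rightarrow> 'a \<Rightarrow> real.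
    prob_space.indep_vars M (\<lambda>_. borel) \<xi> {1..} \<and>
    (\<forall>k\<ge>1. distributed M lborel (\<xi> k) std_normal_density) \<and>
    (AE \<omega> in M.
       set_integrable lborel {0..S} (\<lambda>u. (X u \<omega>)\<^sup>2 / (T - u)\<^sup>2) \<and>
       summable (\<lambda>k. 1 / ((real (Suc k) - 1/2)\<^sup>2 * pi\<^sup>2) * (\<xi> (Suc k) \<omega>)\<^sup>2) \<and>
       (LINT u:{0..S}|lborel. (X u \<omega>)\<^sup>2 / (T - u)\<^sup>2) =
         (ln (T / (T - S)))\<^sup>2 *
         (\<Sum>k. 1 / ((real (Suc k) - 1/2)\<^sup>2 * pi\<^sup>2) * (\<xi> (Suc k) \<omega>)\<^sup>2))"
proof -
  interpret alpha_wiener_bridge M B "1/2" T X by fact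
  interpret bridge_time_change M B T X S
    by unfold_locales (use assms in auto)
  have paths: "AE \<omega> in M. continuous_on {0..1} (\<lambda>v. W v \<omega>)"
    using bridge_paths by eventually_elim (rule W_continuous)
  obtain \<xi> :: "nat \<Rightarrow> 'a \<Rightarrow> real" where indep: "indep_vars (\<lambda>_. borel) \<xi> UNIV"
    and rv: "\<And>k. random_variable borel (\<xi> k)"
    and normal: "\<And>k. distr M borel (\<xi> k) = std_normal_distribution"
    and expansion: "AE \<omega> in M. (\<lambda>k. 1 / ((real k + 1/2)\<^sup>2 * pi\<^sup>2) * (\<xi> k \<omega>)\<^sup>2) sums integral {0..1} (\<lambda>v. (W v \<omega>)\<^sup>2)"
    using Karhunen_Loeve_square_integral[OF W_measurable W_gauss paths W_start] by blast
  show ?thesis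
  \<comment> \<open>The modes are counted from 0, the result from 1. At index 0 truncated
    subtraction repeats the variable of index 1, which lies outside the index set of the
    independence claim.\<close>
  proof (intro exI[of _ "\<lambda>k. \<xi> (k - 1)"] conjI allI impI)
    have "inj_on (\<lambda>k. k - 1) {1::nat..}" by (auto simp: inj_on_def)
    moreover have "indep_vars (\<lambda>_. borel) \<xi> ((\<lambda>k. k - 1) ` {1..})"
      using indep by (rule indep_vars_subset) simp
    ultimately show "indep_vars (\<lambda>_. borel) (\<lambda>k. \<xi> (k - 1)) {1..}"
      by (rule indep_vars_reindex_inj)
    show "distributed M lborel (\<xi> (k - 1)) std_normal_density" for k
    proof -
      have "distr M lborel (\<xi> (k - 1)) = distr M borel (\<xi> (k - 1))"
        by (rule distr_cong) auto
      then show ?thesis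
        using rv normal by (simp add: distributed_def)
    qed
    have half: "real (Suc k) - 1/2 = real k + 1/2" for k by simp
    show "AE \<omega> in M.
       set_integrable lborel {0..S} (\<lambda>u. (X u \<omega>)\<^sup>2 / (T - u)\<^sup>2) \<and>
       summable (\<lambda>k. 1 / ((real (Suc k) - 1/2)\<^sup>2 * pi\<^sup>2) * (\<xi> (Suc k - 1) \<omega>)\<^sup>2) \<and>
       (LINT u:{0..S}|lborel. (X u \<omega>)\<^sup>2 / (T - u)\<^sup>2) =
         (ln (T / (T - S)))\<^sup>2 *
         (\<Sum>k. 1 / ((real (Suc k) - 1/2)\<^sup>2 * pi\<^sup>2) * (\<xi> (Suc k - 1) \<omega>)\<^sup>2)"
      using bridge_paths expansion
    proof eventually_elim
      case (elim \<omega>)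
      from square_integral_time_change[OF elim(1)] sums_summable[OF elim(2)] sums_unique[OF elim(2)]
      show ?case unfolding half diff_Suc_1 L_def by simp
    qed
  qed
qed

end
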